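(* Let $n\ge 1$ be an integer and $v\in\mathbb{C}$. For each domain $\Theta\subset\mathbb{C}$, $$\mathbb{E}[N_\Theta^{\Phi_n,v}]=\iint_\Theta\rho_{n,v}(z)\,dx\,dy,\qquad z=x+iy,$$ where $$\rho_{n,v}(z)=\frac1\pi\left[\frac{K_n^{(1,1)}(z,z)}{K_n(z,z)}-\frac{|K_n^{(0,1)}(z,z)|^2}{K_n(z,z)^2}\left(1-\frac{|v|^2}{K_n(z,z)}\right)\right]\exp\left(-\frac{|v|^2}{K_n(z,z)}\right).$$
   Context: Let $\{\phi_j\}_{j=0}^n$ be polynomials with complex coefficients, $\deg\phi_j=j$ and $\phi_0=1$. Let $\eta_0,\dots,\eta_n$ be independent and identically distributed standard complex normal random variables: $\eta_j=\alpha_j+i\beta_j$ with density $\frac1\pi e^{-z\overline z}$ on $\mathbb{C}$, $\mathbb{E}[\eta_j]=0$, $\mathbb{E}[\eta_j\overline{\eta_j}]=1$ (so $\alpha_j,\beta_j$ are independent real normal variables with mean $0$ and variance $\frac12$). Put $\Phi_n(z)=\sum_{j=0}^n\eta_j\phi_j(z)$. For $v\in\mathbb{C}$ and a domain $\Theta\subset\mathbb{C}$, $N_\Theta^{\Phi_n,v}$ is the (random) number of roots in $\Theta$, counted with multiplicity, of the equation $\Phi_n(z)=v$. Set $K_n(z,w)=\sum_{j=0}^n\phi_j(z)\overline{\phi_j(w)}$ and $K_n^{(k,l)}(z,w)=\sum_{j=0}^n\phi_j^{(k)}(z)\overline{\phi_j^{(l)}(w)}$ for nonnegative integers $k,l$,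 where $\phi_j^{(k)}$ is the $k$-th derivative. *)

theory Defs
  imports "HOL-Probability.Probability" "HOL-Computational_Algebra.Polynomial"
begin

definition std_complex_normal_density :: "complex \<Rightarrow> real" where
  "std_complex_normal_density z = exp (- (cmod z)\<^sup>2) / pi"

definition std_complex_normal :: "'a measure \<Rightarrow> ('a \<Rightarrow> complex) \<Rightarrow> bool" where
  "std_complex_normal M X \<longleftrightarrow> distributed M lborel X (\<lambda>z. ennreal (std_complex_normal_density z))"

definition random_poly ::
  "nat \<Rightarrow> (nat \<Rightarrow> complex poly) \<Rightarrow> (nat \<Rightarrow> 'a \<Rightarrow> complex) \<Rightarrow> 'a \<Rightarrow> complex poly" where
  "random_poly n \<phi> \<eta> \<omega> = (\<Sum>j\<le>n. smult (\<eta> j \<omega>) (\<phi> j))"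

text \<open>Number of solutions of \<open>p z = v\<close> in \<open>\<Theta>\<close>, with multiplicity. If \<open>p\<close> is the constant \<open>v\<close>
  and \<open>\<Theta>\<close> is infinite, the sum ranges over an infinite set and the value is 0.
  For the random polynomial this is an event of probability zero when \<open>n \<ge> 1\<close>.\<close>

definition root_count :: "complex set \<Rightarrow> complex poly \<Rightarrow> complex \<Rightarrow> nat" where
  "root_count \<Theta> p v = (\<Sum>z\<in>{z \<in> \<Theta>. poly p z = v}. order z (p - [:v:]))"

definition kernel ::
  "nat \<Rightarrow> (nat \<Rightarrow> complex poly) \<Rightarrow> nat \<Rightarrow> nat \<Rightarrow> complex \<Rightarrow> complex \<Rightarrow> complex" where
  "kernel n \<phi> k l z w =
    (\<Sum>j\<le>n. poly ((pderiv ^^ k) (\<phi> j)) z * cnj (poly ((pderiv ^^ l) (\<phi> j)) w))"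

lemma kernel_diag:
  "kernel n \<phi> k k z z = of_real (\<Sum>j\<le>n. (cmod (poly ((pderiv ^^ k) (\<phi> j)) z))\<^sup>2)"
  by (simp only: kernel_def complex_norm_square of_real_sum)

text \<open>By the preceding lemma, \<open>kernel n \<phi> k k z z\<close> is real, so taking real parts below
  only changes the type.\<close>

definition root_density ::
  "nat \<Rightarrow> (nat \<Rightarrow> complex poly) \<Rightarrow> complex \<Rightarrow> complex \<Rightarrow> real" where
  "root_density n \<phi> v z =
    (let K = Re (kernel n \<phi> 0 0 z z);
         K11 = Re (kernel n \<phi> 1 1 z z);
         K01 = kernel n \<phi> 0 1 z z
     in 1 / pi * (K11 / K - (cmod K01)\<^sup>2 / K\<^sup>2 * (1 - (cmod v)\<^sup>2 / K)) * exp (- (cmod v)\<^sup>2 / K))"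

end

theory Submission
  imports Defs "HOL-Complex_Analysis.Conformal_Mappings"
begin

text \<open>Since \<open>\<phi> 0 = 1\<close>, the random polynomial is \<open>y + q\<close>, where the Gaussian variable \<open>y\<close> is independent
  of \<open>q = (\<Sum>j=1..n. x j * \<phi> j)\<close>. For fixed \<open>q\<close>, the solutions of \<open>y + q z = v\<close> in \<open>\<Theta>\<close> are the
  preimages of \<open>y\<close> under \<open>v - q\<close>, almost surely all simple (\<open>root_count_eq_card_AE\<close>). Averaging their
  number over \<open>y\<close> with the normal density \<open>g\<close> is therefore a matter of the area formula
  (\<open>area_formula_poly\<close>), which gives the integral of \<open>\<bar>q' z\<bar>\<^sup>2 * g (v - q z)\<close> over \<open>\<Theta>\<close>.

  By Tonelli's theorem the expectation over \<open>x\<close> may be taken for each fixed \<open>z\<close>. There \<open>q z\<close> and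
  \<open>q' z\<close> are linear forms in independent standard normal variables, and the required mean of
  \<open>\<bar>q' z\<bar>\<^sup>2 * g (v - q z)\<close> is computed by integrating out one variable after the other
  (\<open>nn_integral_gaussian_linear_forms\<close>): completing the square reproduces an integrand of the same
  shape. The outcome is the stated density (\<open>root_density_altdef\<close>).

  Knowing the count almost everywhere is not enough for integrability, since the probability space
  need not be complete: the number of roots must itself be a measurable function. This holds because the
  polynomials of bounded degree with at least \<open>k\<close> roots in a compact set, counted with multiplicity, form a closed set
  together with the zero polynomial, and an open set is exhausted by compact ones
  (\<open>measurable_root_count\<close>).\<close>

section \<open>Integrals of linear forms in complex Gaussian variables\<close>

lemma nn_integral_gaussian_real_even_moment:
  "(\<integral>\<^sup>+x. ennreal (exp (- (x::real)\<^sup>2) * x ^ (2 * k)) \<partial>lborel) =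
     ennreal (sqrt pi * (fact (2 * k) / (2 ^ (2 * k) * fact k)))"
proof -
  have "has_bochner_integral lborel (\<lambda>x::real. exp (- x\<^sup>2) * x ^ (2 * k))
          (2 *\<^sub>R ((sqrt pi / 2) * (fact (2 * k) / (2 ^ (2 * k) * fact k))))"
    by (rule has_bochner_integral_even_function[OF gaussian_moment_even_pos]) simp
  then show ?thesis
    by (subst nn_integral_eq_integral)
       (auto simp: has_bochner_integral_iff zero_le_mult_iff zero_le_even_power)
qed

lemma nn_integral_std_complex_normal:
  shows nn_integral_std_complex_normal_density:
      "(\<integral>\<^sup>+z. ennreal (std_complex_normal_density z) \<partial>lborel) = 1"
    and nn_integral_std_complex_normal_cmod2:
      "(\<integral>\<^sup>+z. ennreal (std_complex_normal_density z * (cmod z)\<^sup>2) \<partial>lborel) = 1"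
proof -
  define g0 where "g0 = (\<lambda>x::real. exp (- x\<^sup>2))"
  define g2 where "g2 = (\<lambda>x::real. exp (- x\<^sup>2) * x\<^sup>2)"
  have m0: "(\<integral>\<^sup>+x. ennreal (g0 x) \<partial>lborel) = ennreal (sqrt pi)"
    using nn_integral_gaussian_real_even_moment[of 0] by (simp add: g0_def)
  have m2: "(\<integral>\<^sup>+x. ennreal (g2 x) \<partial>lborel) = ennreal (sqrt pi / 2)"
    using nn_integral_gaussian_real_even_moment[of 1] by (simp add: g2_def)
  have [measurable]: "g0 \<in> borel_measurable borel" "g2 \<in> borel_measurable borel"
    unfolding g0_def g2_def by measurable
  have prod: "(\<integral>\<^sup>+z. ennreal (f (Re z) * h (Im z)) \<partial>lborel) =
      (\<integral>\<^sup>+x. ennreal (f x) \<partial>lborel) * (\<integral>\<^sup>+x. ennreal (h x) \<partial>lborel)"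
    if [measurable]: "f \<in> borel_measurable borel" "h \<in> borel_measurable borel"
      and "\<And>x. f x \<ge> 0" "\<And>x. h x \<ge> 0" for f h :: "real \<Rightarrow> real"
  proof -
    define F where "F = (\<lambda>b::complex. if b = 1 then f else h)"
    have "(\<integral>\<^sup>+z. (\<Prod>b\<in>Basis. ennreal (F b (z \<bullet> b))) \<partial>lborel) =
            (\<Prod>b\<in>(Basis::complex set). (\<integral>\<^sup>+x. ennreal (F b x) \<partial>lborel))"
      by (rule nn_integral_lborel_prod) (auto simp: F_def)
    then show ?thesis
      using that by (simp add: Basis_complex_def F_def complex_inner_1_right ennreal_mult complex_inner_i_right)
  qed
  have e0: "ennreal (std_complex_normal_density z) = ennreal (1/pi) * ennreal (g0 (Re z) * g0 (Im z))" for z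
    by (simp add: std_complex_normal_density_def g0_def cmod_power2 ennreal_mult[symmetric]
        exp_add[symmetric] exp_diff[symmetric])
  have e2: "ennreal (std_complex_normal_density z * (cmod z)\<^sup>2) =
     ennreal (1/pi) * (ennreal (g2 (Re z) * g0 (Im z)) + ennreal (g0 (Re z) * g2 (Im z)))" for z
  proof -
    have "std_complex_normal_density z * (cmod z)\<^sup>2 =
        1 / pi * (g2 (Re z) * g0 (Im z) + g0 (Re z) * g2 (Im z))"
      by (simp add: std_complex_normal_density_def g0_def g2_def cmod_power2
        exp_add exp_diff exp_minus field_simps)
    then show ?thesis
      by (simp add: g0_def g2_def ennreal_mult[symmetric] ennreal_plus[symmetric] del: ennreal_plus)
  qed
  have m00: "(\<integral>\<^sup>+z. ennreal (g0 (Re z) * g0 (Im z)) \<partial>lborel) = ennreal pi"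
    by (subst prod) (simp_all add: m0 ennreal_mult[symmetric], simp_all add: g0_def)
  have m20: "(\<integral>\<^sup>+z. ennreal (g2 (Re z) * g0 (Im z)) \<partial>lborel) = ennreal (pi / 2)"
    by (subst prod) (simp_all add: m0 m2 ennreal_mult[symmetric], simp_all add: g0_def g2_def)
  have m02: "(\<integral>\<^sup>+z. ennreal (g0 (Re z) * g2 (Im z)) \<partial>lborel) = ennreal (pi / 2)"
    by (subst prod) (simp_all add: m0 m2 ennreal_mult[symmetric], simp_all add: g0_def g2_def)
  show "(\<integral>\<^sup>+z. ennreal (std_complex_normal_density z) \<partial>lborel) = 1"
    unfolding e0 by (simp add: nn_integral_cmult m00 ennreal_mult[symmetric])
  show "(\<integral>\<^sup>+z. ennreal (std_complex_normal_density z * (cmod z)\<^sup>2) \<partial>lborel) = 1"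
    unfolding e2
    by (simp add: nn_integral_cmult nn_integral_add m20 m02 ennreal_mult[symmetric]
        ennreal_plus[symmetric] del: ennreal_plus)
qed

lemma std_complex_normal_density_measurable [measurable]:
  "std_complex_normal_density \<in> borel_measurable borel"
  unfolding std_complex_normal_density_def[abs_def] by measurable

lemma std_complex_normal_density_nonneg: "std_complex_normal_density z \<ge> 0"
  by (simp add: std_complex_normal_density_def)

lemma nn_integral_lborel_affine:
  fixes f :: "'b::euclidean_space \<Rightarrow> ennreal"
  assumes [measurable]: "f \<in> borel_measurable borel" and "c \<noteq> 0"
  shows "(\<integral>\<^sup>+z. f z \<partial>lborel) = (\<integral>\<^sup>+z. ennreal (\<bar>c\<bar> ^ DIM('b)) * f (t + c *\<^sub>R z) \<partial>lborel)"
  by (subst lborel_affine[OF assms(2), of t])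
     (simp add: nn_integral_density nn_integral_distr)

text \<open>The cross term \<open>2 * Re (cnj c * b * z)\<close> has mean zero by the symmetry \<open>z \<mapsto> -z\<close>. Averaging the
  integrand with its reflection removes this term by the parallelogram law, so that only
  nonnegative integrands occur and no integrability has to be checked.\<close>
lemma nn_integral_gaussian_quadratic:
  fixes c b :: complex
  assumes "E \<ge> 0"
  shows "(\<integral>\<^sup>+z. ennreal (std_complex_normal_density z * ((cmod (c + b * z))\<^sup>2 + E)) \<partial>lborel)
           = ennreal ((cmod c)\<^sup>2 + (cmod b)\<^sup>2 + E)" (is "?I = _")
proof -
  define g where "g = std_complex_normal_density"
  have g0: "g z \<ge> 0" "g (- z) = g z" for z
    by (simp_all add: g_def std_complex_normal_density_def)
  have [measurable]: "g \<in> borel_measurable borel" by (simp add: g_def)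
  have refl: "?I = (\<integral>\<^sup>+z. ennreal (g z * ((cmod (c - b * z))\<^sup>2 + E)) \<partial>lborel)"
    by (subst nn_integral_lborel_affine[of _ "-1" 0]) (simp_all add: g0 flip: g_def)
  have "?I + ?I = (\<integral>\<^sup>+z. ennreal (g z * ((cmod (c + b * z))\<^sup>2 + E)) +
                     ennreal (g z * ((cmod (c - b * z))\<^sup>2 + E)) \<partial>lborel)"
    by (subst (2) refl) (simp add: nn_integral_add flip: g_def)
  also have "\<dots> = (\<integral>\<^sup>+z. ennreal (2 * ((cmod c)\<^sup>2 + E)) * ennreal (g z) +
                    ennreal (2 * (cmod b)\<^sup>2) * ennreal (g z * (cmod z)\<^sup>2) \<partial>lborel)"
  proof (rule nn_integral_cong)
    fix z
    have "g z * ((cmod (c + b * z))\<^sup>2 + E) + g z * ((cmod (c - b * z))\<^sup>2 + E) =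
          2 * ((cmod c)\<^sup>2 + E) * g z + 2 * (cmod b)\<^sup>2 * (g z * (cmod z)\<^sup>2)"
      unfolding cmod_power2 by (simp add: power2_eq_square algebra_simps)
    then show "ennreal (g z * ((cmod (c + b * z))\<^sup>2 + E)) + ennreal (g z * ((cmod (c - b * z))\<^sup>2 + E)) =
        ennreal (2 * ((cmod c)\<^sup>2 + E)) * ennreal (g z) +
                    ennreal (2 * (cmod b)\<^sup>2) * ennreal (g z * (cmod z)\<^sup>2)"
      using assms g0 by (simp add: ennreal_mult[symmetric] ennreal_plus[symmetric] del: ennreal_plus)
  qed
  also have "\<dots> = ennreal (2 * ((cmod c)\<^sup>2 + E)) + ennreal (2 * (cmod b)\<^sup>2)"
    using nn_integral_std_complex_normal
    by (simp add: nn_integral_add nn_integral_cmult flip: g_def)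
  finally have "?I + ?I = ennreal (2 * ((cmod c)\<^sup>2 + E)) + ennreal (2 * (cmod b)\<^sup>2)" .
  also have "\<dots> = ennreal (2 * ((cmod c)\<^sup>2 + (cmod b)\<^sup>2 + E))"
    using assms by (subst ennreal_plus[symmetric]) (auto simp: algebra_simps)
  also have "\<dots> = 2 * ennreal ((cmod c)\<^sup>2 + (cmod b)\<^sup>2 + E)"
    using assms by (subst ennreal_mult) auto
  finally have "2 * ?I = 2 * ennreal ((cmod c)\<^sup>2 + (cmod b)\<^sup>2 + E)"
    by (subst mult_2)
  then show ?thesis
    by (subst (asm) ennreal_mult_cancel_left) auto
qed

lemma nn_integral_gaussian_quadratic_shifted:
  fixes c b m :: complex
  assumes "E \<ge> 0" "t > 0"
  shows "(\<integral>\<^sup>+z. ennreal (exp (- (cmod (z - m))\<^sup>2 / t) / (pi * t) * ((cmod (c + b * z))\<^sup>2 + E)) \<partial>lborel)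
           = ennreal ((cmod (c + b * m))\<^sup>2 + (cmod b)\<^sup>2 * t + E)" (is "?I = _")
proof -
  have [simp]: "t \<noteq> 0" using assms by simp
  have "?I = (\<integral>\<^sup>+z. ennreal (std_complex_normal_density z *
               ((cmod ((c + b * m) + (b * of_real (sqrt t)) * z))\<^sup>2 + E)) \<partial>lborel)"
  proof (rule trans[OF nn_integral_lborel_affine[of _ "sqrt t" m]], simp, simp, intro nn_integral_cong)
    fix z
    show "ennreal (\<bar>sqrt t\<bar> ^ DIM(complex)) * ennreal (exp (- (cmod (m + sqrt t *\<^sub>R z - m))\<^sup>2 / t) / (pi * t) *
        ((cmod (c + b * (m + sqrt t *\<^sub>R z)))\<^sup>2 + E)) =
      ennreal (std_complex_normal_density z *
               ((cmod ((c + b * m) + (b * of_real (sqrt t)) * z))\<^sup>2 + E))"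
      using assms by (simp add: ennreal_mult[symmetric] std_complex_normal_density_def
          scaleR_conv_of_real norm_mult power_mult_distrib algebra_simps)
  qed
  also have "\<dots> = ennreal ((cmod (c + b * m))\<^sup>2 + (cmod b)\<^sup>2 * t + E)"
    using assms by (subst nn_integral_gaussian_quadratic) (auto simp: norm_mult power_mult_distrib)
  finally show ?thesis .
qed

text \<open>Completing the square in \<open>z\<close>: if \<open>z\<close> is standard normal and \<open>v - z * a\<close> is an independent normal
  variable of variance \<open>K\<close>, then \<open>v\<close> has variance \<open>L\<close>, and given \<open>v\<close> the variable \<open>z\<close> is normal with
  mean \<open>cnj a * v / L\<close> and variance \<open>K / L\<close>.\<close>
lemma gaussian_complete_square:
  fixes v a z :: complex and K :: real
  assumes "K > 0"
  defines "L \<equiv> K + (cmod a)\<^sup>2"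
  shows "(cmod z)\<^sup>2 + (cmod (v - z * a))\<^sup>2 / K =
     (cmod v)\<^sup>2 / L + (cmod (z - cnj a * v / of_real L))\<^sup>2 / (K / L)"
proof -
  have L: "L > 0" unfolding L_def using assms by (simp add: add_pos_nonneg)
  have "(cmod (z - cnj a * v / of_real L))\<^sup>2 = (cmod (of_real L * z - cnj a * v))\<^sup>2 / L\<^sup>2"
  proof -
    have "z - cnj a * v / of_real L = (of_real L * z - cnj a * v) / of_real L"
      using L by (simp add: field_simps)
    then show ?thesis using L by (simp add: norm_divide power_divide)
  qed
  moreover have "K * L * (cmod z)\<^sup>2 + L * (cmod (v - z * a))\<^sup>2 =
      K * (cmod v)\<^sup>2 + (cmod (of_real L * z - cnj a * v))\<^sup>2"
    unfolding L_def cmod_power2 by (simp add: power2_eq_square algebra_simps)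
  ultimately show ?thesis
    using assms(1) L by (simp add: field_simps power2_eq_square)
qed


text \<open>Integrating out one variable. The class of functions of \<open>v\<close> and \<open>c\<close> on the left, a centred
  Gaussian in \<open>v\<close> of variance \<open>K\<close> times the squared modulus of an affine form plus a constant, is
  reproduced on the right with new parameters, which is what lets the step be iterated.\<close>
lemma nn_integral_gaussian_step:
  fixes a b c d v :: complex and K E :: real
  assumes "K > 0" "E \<ge> 0"
  defines "L \<equiv> K + (cmod a)\<^sup>2"
  shows "(\<integral>\<^sup>+z. ennreal (std_complex_normal_density z *
            (exp (- (cmod (v - z * a))\<^sup>2 / K) / (pi * K) *
              ((cmod ((c + z * b) + (v - z * a) * d))\<^sup>2 + E))) \<partial>lborel) =
     ennreal (exp (- (cmod v)\<^sup>2 / L) / (pi * L) *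
        ((cmod (c + v * d + (b - a * d) * (cnj a * v / of_real L)))\<^sup>2
           + ((cmod (b - a * d))\<^sup>2 * (K / L) + E)))"
proof -
  have L: "L > 0" unfolding L_def using assms by (simp add: add_pos_nonneg)
  define m where "m = cnj a * v / of_real L"
  have "ennreal (std_complex_normal_density z *
            (exp (- (cmod (v - z * a))\<^sup>2 / K) / (pi * K) *
              ((cmod ((c + z * b) + (v - z * a) * d))\<^sup>2 + E))) =
        ennreal (exp (- (cmod v)\<^sup>2 / L) / (pi * L)) *
        ennreal (exp (- (cmod (z - m))\<^sup>2 / (K / L)) / (pi * (K / L)) *
          ((cmod ((c + v * d) + (b - a * d) * z))\<^sup>2 + E))" for z
  proof -
    have e: "exp (- (cmod z)\<^sup>2) * exp (- (cmod (v - z * a))\<^sup>2 / K) =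
        exp (- (cmod v)\<^sup>2 / L) * exp (- (cmod (z - m))\<^sup>2 / (K / L))"
      unfolding exp_add[symmetric]
      using gaussian_complete_square[OF assms(1), where v=v and z=z and a=a]
      by (intro arg_cong[where f=exp]) (simp add: L_def m_def)
    have q: "(c + z * b) + (v - z * a) * d = (c + v * d) + (b - a * d) * z"
      by (simp add: algebra_simps)
    have "std_complex_normal_density z *
            (exp (- (cmod (v - z * a))\<^sup>2 / K) / (pi * K) *
              ((cmod ((c + z * b) + (v - z * a) * d))\<^sup>2 + E)) =
          (exp (- (cmod z)\<^sup>2) * exp (- (cmod (v - z * a))\<^sup>2 / K)) / (pi * pi * K) *
            ((cmod ((c + v * d) + (b - a * d) * z))\<^sup>2 + E)"
      unfolding q std_complex_normal_density_def by simp
    also have "\<dots> = (exp (- (cmod v)\<^sup>2 / L) / (pi * L)) *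
        (exp (- (cmod (z - m))\<^sup>2 / (K / L)) / (pi * (K / L)) *
          ((cmod ((c + v * d) + (b - a * d) * z))\<^sup>2 + E))"
      unfolding e using L assms(1) by (simp add: field_simps)
    finally have eq: "std_complex_normal_density z *
            (exp (- (cmod (v - z * a))\<^sup>2 / K) / (pi * K) *
              ((cmod ((c + z * b) + (v - z * a) * d))\<^sup>2 + E)) = \<dots>" .
    show ?thesis
      unfolding eq using L assms(1,2) by (intro ennreal_mult) auto
  qed
  then have "(\<integral>\<^sup>+z. ennreal (std_complex_normal_density z *
            (exp (- (cmod (v - z * a))\<^sup>2 / K) / (pi * K) *
              ((cmod ((c + z * b) + (v - z * a) * d))\<^sup>2 + E))) \<partial>lborel) =
      ennreal (exp (- (cmod v)\<^sup>2 / L) / (pi * L)) *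
      ennreal ((cmod ((c + v * d) + (b - a * d) * m))\<^sup>2 + (cmod (b - a * d))\<^sup>2 * (K / L) + E)"
    using nn_integral_gaussian_quadratic_shifted[OF assms(2), of "K / L"] L assms(1)
    by (simp add: nn_integral_cmult)
  also have "\<dots> = ennreal (exp (- (cmod v)\<^sup>2 / L) / (pi * L) *
      ((cmod ((c + v * d) + (b - a * d) * m))\<^sup>2 + (cmod (b - a * d))\<^sup>2 * (K / L) + E))"
    using L assms(1,2) by (intro ennreal_mult[symmetric]) auto
  finally show ?thesis
    by (simp only: m_def add.assoc)
qed

definition std_complex_normal_measure :: "complex measure" where
  "std_complex_normal_measure = density lborel (\<lambda>z. ennreal (std_complex_normal_density z))"

lemma sets_std_complex_normal_measure [simp, measurable_cong]:
  "sets std_complex_normal_measure = sets borel"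
  by (simp add: std_complex_normal_measure_def)

lemma space_std_complex_normal_measure [simp]: "space std_complex_normal_measure = UNIV"
  by (simp add: std_complex_normal_measure_def)

lemma prob_space_std_complex_normal_measure: "prob_space std_complex_normal_measure"
  by (rule prob_spaceI)
     (simp add: std_complex_normal_measure_def emeasure_density nn_integral_std_complex_normal)

lemma nn_integral_std_complex_normal_measure:
  assumes [measurable]: "f \<in> borel_measurable borel"
  shows "(\<integral>\<^sup>+z. f z \<partial>std_complex_normal_measure) =
    (\<integral>\<^sup>+z. ennreal (std_complex_normal_density z) * f z \<partial>lborel)"
  by (simp add: std_complex_normal_measure_def nn_integral_density)

lemma product_sigma_finite_std_complex_normal:
  "product_sigma_finite (\<lambda>_. std_complex_normal_measure)"
proof -
  interpret prob_space std_complex_normal_measure by (rule prob_space_std_complex_normal_measure)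
  show ?thesis by standard
qed

lemma borel_measurable_coord_std_complex_normal:
  "j \<in> J \<Longrightarrow> (\<lambda>x. x j) \<in> borel_measurable (PiM J (\<lambda>_. std_complex_normal_measure))"
  using measurable_component_singleton[of j J "\<lambda>_. std_complex_normal_measure"]
  by (simp cong: measurable_cong_sets)

text \<open>With \<open>X = (\<Sum>j\<in>J. x j * a j)\<close> and \<open>Y = (\<Sum>j\<in>J. x j * b j)\<close>, this is the expectation of
  \<open>\<bar>c + Y\<bar>\<^sup>2\<close> weighted by the density of a further standard normal variable at \<open>v - X\<close>. That variable
  plus \<open>X\<close> is normal of variance \<open>K\<close>, the covariance of \<open>Y\<close> with it is \<open>B\<close>, and \<open>R\<close> is the
  conditional variance of \<open>Y\<close> given it; hence \<open>R \<ge> 0\<close>, a form of the Cauchy-Schwarz inequality. The induction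
  on \<open>J\<close> needs arbitrary \<open>c\<close> and \<open>v\<close>, because a variable that is still to be integrated shifts both.\<close>
lemma nn_integral_gaussian_linear_forms:
  fixes a b :: "'i \<Rightarrow> complex" and c v :: complex
  assumes "finite J"
  defines "K \<equiv> 1 + (\<Sum>j\<in>J. (cmod (a j))\<^sup>2)"
    and "B \<equiv> (\<Sum>j\<in>J. b j * cnj (a j))"
  defines "R \<equiv> (\<Sum>j\<in>J. (cmod (b j))\<^sup>2) - (cmod B)\<^sup>2 / K"
  shows "R \<ge> 0"
    and "(\<integral>\<^sup>+x. ennreal (std_complex_normal_density (v - (\<Sum>j\<in>J. x j * a j)) *
              (cmod (c + (\<Sum>j\<in>J. x j * b j)))\<^sup>2) \<partial>PiM J (\<lambda>_. std_complex_normal_measure)) =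
        ennreal (exp (- (cmod v)\<^sup>2 / K) / (pi * K) * ((cmod (c + v * (B / of_real K)))\<^sup>2 + R))"
proof -
  interpret product_sigma_finite "\<lambda>_::'i. std_complex_normal_measure"
    by (rule product_sigma_finite_std_complex_normal)
  \<comment> \<open>The parameters as functions of the index set, which changes during the induction.\<close>
  define KK BB RR where
    "KK = (\<lambda>J. 1 + (\<Sum>j\<in>J. (cmod (a j))\<^sup>2))" and
    "BB = (\<lambda>J. \<Sum>j\<in>J. b j * cnj (a j))" and
    "RR = (\<lambda>J. (\<Sum>j\<in>J. (cmod (b j))\<^sup>2) - (cmod (BB J))\<^sup>2 / KK J)"
  have "RR J \<ge> 0 \<and> (\<forall>v c. (\<integral>\<^sup>+x. ennreal (std_complex_normal_density (v - (\<Sum>j\<in>J. x j * a j)) *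
              (cmod (c + (\<Sum>j\<in>J. x j * b j)))\<^sup>2) \<partial>PiM J (\<lambda>_. std_complex_normal_measure)) =
        ennreal (exp (- (cmod v)\<^sup>2 / KK J) / (pi * KK J) *
          ((cmod (c + v * (BB J / of_real (KK J))))\<^sup>2 + RR J)))"
    using assms(1)
  proof (induction J rule: finite_induct)
    case empty
    then show ?case
      by (simp add: KK_def BB_def RR_def PiM_empty std_complex_normal_density_def)
  next
    case (insert i J)
    let ?K = "KK J" and ?L = "KK (insert i J)" and ?d = "BB J / of_real (KK J)"
    have K: "?K > 0" "?L > 0"
      unfolding KK_def by (auto intro!: add_pos_nonneg sum_nonneg)
    have L: "?L = ?K + (cmod (a i))\<^sup>2"
      using insert.hyps by (simp add: KK_def)
    have BBi: "BB (insert i J) = BB J + b i * cnj (a i)"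
      using insert.hyps by (simp add: BB_def)
    have d: "?d + (b i - a i * ?d) * cnj (a i) / of_real ?L = BB (insert i J) / of_real ?L"
    proof -
      have "of_real ?L = of_real ?K + a i * cnj (a i)"
        by (simp add: L complex_norm_square del: of_real_power)
      then have "?d * of_real ?L + (b i - a i * ?d) * cnj (a i) = ?d * of_real ?K + b i * cnj (a i)"
        by (simp add: algebra_simps)
      also have "\<dots> = BB (insert i J)"
        using K by (simp add: BBi)
      finally show ?thesis
        using K by (simp add: add_divide_eq_iff)
    qed
    have R: "(cmod (b i - a i * ?d))\<^sup>2 * (?K / ?L) + RR J = RR (insert i J)"
    proof -
      have q: "(cmod (b i - a i * ?d))\<^sup>2 = (cmod (of_real ?K * b i - a i * BB J))\<^sup>2 / ?K\<^sup>2"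
      proof -
        have "b i - a i * ?d = (of_real ?K * b i - a i * BB J) / of_real ?K"
          using K by (simp add: field_simps)
        then show ?thesis using K by (simp add: norm_divide power_divide)
      qed
      have "(cmod (of_real ?K * b i - a i * BB J))\<^sup>2 + ?K * (cmod (BB J + b i * cnj (a i)))\<^sup>2 =
         ?K * ?L * (cmod (b i))\<^sup>2 + ?L * (cmod (BB J))\<^sup>2"
        unfolding L cmod_power2 by (simp add: power2_eq_square algebra_simps)
      then have "(cmod (of_real ?K * b i - a i * BB J))\<^sup>2 =
         ?K * ?L * (cmod (b i))\<^sup>2 + ?L * (cmod (BB J))\<^sup>2 - ?K * (cmod (BB (insert i J)))\<^sup>2"
        by (simp add: BBi)
      moreover have "(k * l * s + l * x - k * y) / k\<^sup>2 * (k / l) = s + x / k - y / l"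
        if "k > 0" "l > 0" for k l s x y :: real
        using that by (simp add: field_simps power2_eq_square)
      ultimately show ?thesis
        unfolding q RR_def using insert.hyps K by simp
    qed
    have R0: "RR (insert i J) \<ge> 0"
      unfolding R[symmetric] using insert.IH K by (intro add_nonneg_nonneg mult_nonneg_nonneg) auto
    have meas: "(\<lambda>x. ennreal (std_complex_normal_density (v - (\<Sum>j\<in>insert i J. x j * a j)) *
              (cmod (c + (\<Sum>j\<in>insert i J. x j * b j)))\<^sup>2))
          \<in> borel_measurable (PiM (insert i J) (\<lambda>_. std_complex_normal_measure))" for v c
    proof -
      have [measurable]: "(\<lambda>x. \<Sum>j\<in>insert i J. x j * h j)
          \<in> borel_measurable (PiM (insert i J) (\<lambda>_. std_complex_normal_measure))" for h :: "'i \<Rightarrow> complex"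
        by (intro borel_measurable_sum borel_measurable_times
            borel_measurable_coord_std_complex_normal borel_measurable_const)
      show ?thesis by measurable
    qed
    have "(\<integral>\<^sup>+x. ennreal (std_complex_normal_density (v - (\<Sum>j\<in>insert i J. x j * a j)) *
              (cmod (c + (\<Sum>j\<in>insert i J. x j * b j)))\<^sup>2)
              \<partial>PiM (insert i J) (\<lambda>_. std_complex_normal_measure)) =
        ennreal (exp (- (cmod v)\<^sup>2 / ?L) / (pi * ?L) *
          ((cmod (c + v * (BB (insert i J) / of_real ?L)))\<^sup>2 + RR (insert i J)))" for v c
    proof -
      have upd: "(\<Sum>j\<in>insert i J. (x(i := y)) j * h j) = y * h i + (\<Sum>j\<in>J. x j * h j)"
        for x :: "'i \<Rightarrow> complex" and y and h :: "'i \<Rightarrow> complex"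
        using insert.hyps by (simp, intro sum.cong) auto
      have "(\<integral>\<^sup>+x. ennreal (std_complex_normal_density (v - (\<Sum>j\<in>insert i J. x j * a j)) *
              (cmod (c + (\<Sum>j\<in>insert i J. x j * b j)))\<^sup>2)
              \<partial>PiM (insert i J) (\<lambda>_. std_complex_normal_measure)) =
        (\<integral>\<^sup>+y. (\<integral>\<^sup>+x. ennreal (std_complex_normal_density ((v - y * a i) - (\<Sum>j\<in>J. x j * a j)) *
              (cmod ((c + y * b i) + (\<Sum>j\<in>J. x j * b j)))\<^sup>2)
              \<partial>PiM J (\<lambda>_. std_complex_normal_measure)) \<partial>std_complex_normal_measure)"
        by (subst product_nn_integral_insert_rev[OF insert.hyps meas]) (simp only: upd diff_diff_eq add.assoc)
      also have "\<dots> = (\<integral>\<^sup>+y. ennreal (exp (- (cmod (v - y * a i))\<^sup>2 / ?K) / (pi * ?K) *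
          ((cmod ((c + y * b i) + (v - y * a i) * ?d))\<^sup>2 + RR J)) \<partial>std_complex_normal_measure)"
        using insert.IH by simp
      also have "\<dots> = (\<integral>\<^sup>+y. ennreal (std_complex_normal_density y *
          (exp (- (cmod (v - y * a i))\<^sup>2 / ?K) / (pi * ?K) *
          ((cmod ((c + y * b i) + (v - y * a i) * ?d))\<^sup>2 + RR J))) \<partial>lborel)"
        using insert.IH K
        by (subst nn_integral_std_complex_normal_measure, measurable)
           (auto intro!: nn_integral_cong ennreal_mult[symmetric] mult_nonneg_nonneg divide_nonneg_nonneg
             simp: std_complex_normal_density_nonneg simp del: times_divide_eq_left)
      also have "\<dots> = ennreal (exp (- (cmod v)\<^sup>2 / ?L) / (pi * ?L) *
        ((cmod (c + v * ?d + (b i - a i * ?d) * (cnj (a i) * v / of_real ?L)))\<^sup>2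
           + ((cmod (b i - a i * ?d))\<^sup>2 * (?K / ?L) + RR J)))"
        unfolding L using insert.IH K(1) by (intro nn_integral_gaussian_step) auto
      also have "c + v * ?d + (b i - a i * ?d) * (cnj (a i) * v / of_real ?L) =
          c + v * (?d + (b i - a i * ?d) * cnj (a i) / of_real ?L)"
        by (simp add: ring_distribs)
      finally show ?thesis unfolding R d .
    qed
    with R0 show ?case by blast
  qed
  then show "R \<ge> 0" and "(\<integral>\<^sup>+x. ennreal (std_complex_normal_density (v - (\<Sum>j\<in>J. x j * a j)) *
              (cmod (c + (\<Sum>j\<in>J. x j * b j)))\<^sup>2) \<partial>PiM J (\<lambda>_. std_complex_normal_measure)) =
        ennreal (exp (- (cmod v)\<^sup>2 / K) / (pi * K) * ((cmod (c + v * (B / of_real K)))\<^sup>2 + R))"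
    unfolding KK_def BB_def RR_def R_def K_def B_def by blast+
qed

section \<open>The area formula for polynomials\<close>

text \<open>The change of variables theorem for the Lebesgue measure concerns maps of \<open>real ^ 'n\<close>. It is
  carried over to the complex plane along the linear isometry between \<open>real ^ 2\<close> and \<open>complex\<close>.\<close>

definition complex_of_vec :: "real ^ 2 \<Rightarrow> complex" where
  "complex_of_vec x = Complex (x $ 1) (x $ 2)"

definition vec_of_complex :: "complex \<Rightarrow> real ^ 2" where
  "vec_of_complex z = vector [Re z, Im z]"

lemma complex_of_vec_inverse [simp]: "vec_of_complex (complex_of_vec x) = x"
  by (simp add: vec_of_complex_def complex_of_vec_def vec_eq_iff forall_2)

lemma vec_of_complex_inverse [simp]: "complex_of_vec (vec_of_complex z) = z"
  by (simp add: vec_of_complex_def complex_of_vec_def complex_eq_iff)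

lemma bounded_linear_complex_of_vec: "bounded_linear complex_of_vec"
proof -
  have "linear complex_of_vec"
    by (rule linearI) (auto simp: complex_of_vec_def complex_eq_iff)
  then show ?thesis by (rule linear_conv_bounded_linear[THEN iffD1])
qed

lemma bounded_linear_vec_of_complex: "bounded_linear vec_of_complex"
proof -
  have "linear vec_of_complex"
    by (rule linearI) (auto simp: vec_of_complex_def vec_eq_iff forall_2)
  then show ?thesis by (rule linear_conv_bounded_linear[THEN iffD1])
qed

lemma borel_measurable_complex_of_vec [measurable]: "complex_of_vec \<in> borel_measurable borel"
  by (intro borel_measurable_continuous_onI linear_continuous_on bounded_linear_complex_of_vec)

lemma borel_measurable_vec_of_complex [measurable]: "vec_of_complex \<in> borel_measurable borel"
  by (intro borel_measurable_continuous_onI linear_continuous_on bounded_linear_vec_of_complex)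

lemma lborel_complex_eq_distr: "(lborel :: complex measure) = distr lborel borel complex_of_vec"
proof (rule lborel_eqI)
  fix l u :: complex
  assume "\<And>b. b \<in> Basis \<Longrightarrow> l \<bullet> b \<le> u \<bullet> b"
  from this[of 1] this[of \<i>] have le: "Re l \<le> Re u" "Im l \<le> Im u"
    by (auto simp: Basis_complex_def complex_inner_i_right complex_inner_1_right)
  have basis2: "Basis = {axis 1 1, axis 2 1 :: real ^ 2}"
    by (auto simp: Basis_vec_def exhaust_2 UNIV_2)
  have ne: "axis 1 1 \<noteq> (axis 2 1 :: real ^ 2)" by (simp add: axis_eq_axis)
  have pre: "complex_of_vec -` box l u = box (vec_of_complex l) (vec_of_complex u)"
    by (auto simp: complex_of_vec_def vec_of_complex_def in_box_complex_iff mem_box_cart forall_2)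
  have "emeasure (distr lborel borel complex_of_vec) (box l u) =
        emeasure lborel (box (vec_of_complex l) (vec_of_complex u))"
    by (simp add: emeasure_distr pre)
  also have "\<dots> = (\<Prod>b\<in>Basis. (vec_of_complex u - vec_of_complex l) \<bullet> b)"
    using le by (intro emeasure_lborel_box)
      (auto simp: basis2 Basis_complex_def inner_axis vec_of_complex_def complex_inner_i_right complex_inner_1_right)
  also have "\<dots> = (\<Prod>b\<in>Basis. (u - l) \<bullet> b)"
    using ne by (simp add: basis2 Basis_complex_def inner_axis vec_of_complex_def
        complex_inner_i_right complex_inner_1_right)
  finally show "emeasure (distr lborel borel complex_of_vec) (box l u) = (\<Prod>b\<in>Basis. (u - l) \<bullet> b)" .
qed simp

text \<open>By the Cauchy-Riemann equations, the real Jacobian of a holomorphic function with derivative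
  \<open>c\<close> is this determinant.\<close>
lemma det_matrix_complex_mult:
  "det (matrix (\<lambda>h. vec_of_complex (c * complex_of_vec h))) = (cmod c)\<^sup>2"
  unfolding cmod_power2
  by (simp add: det_2 matrix_def vec_of_complex_def complex_of_vec_def axis_def power2_eq_square)

text \<open>Boundedness of \<open>S\<close> bounds the derivative on \<open>S\<close>, so that both sides are finite and the change
  of variables theorem for finite measures applies.\<close>
lemma emeasure_holomorphic_image:
  fixes f :: "complex \<Rightarrow> complex"
  assumes hol: "f holomorphic_on UNIV" and S [measurable]: "S \<in> sets borel" and "bounded S"
    and inj: "inj_on f S" and img: "f ` S \<in> sets borel"
  shows "emeasure lborel (f ` S) = (\<integral>\<^sup>+z. ennreal ((cmod (deriv f z))\<^sup>2) * indicator S z \<partial>lborel)"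
proof -
  have cont: "continuous_on UNIV (deriv f)"
    by (intro holomorphic_on_imp_continuous_on holomorphic_deriv hol) simp
  then have [measurable]: "deriv f \<in> borel_measurable borel"
    by (rule borel_measurable_continuous_onI)
  define S' where "S' = complex_of_vec -` S"
  define F where "F = vec_of_complex \<circ> f \<circ> complex_of_vec"
  define J where "J = (\<lambda>x. (cmod (deriv f (complex_of_vec x)))\<^sup>2)"
  have S'eq: "S' = vec_of_complex ` S"
    unfolding S'_def by (auto simp: image_iff) (metis complex_of_vec_inverse)
  have [measurable]: "S' \<in> sets borel"
    unfolding S'_def using measurable_sets[OF borel_measurable_complex_of_vec S] by simp
  have [measurable]: "J \<in> borel_measurable borel" unfolding J_def by measurable
  have "bounded S'"
    unfolding S'eq by (intro bounded_linear_image assms bounded_linear_vec_of_complex)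
  have "compact (closure S)" using \<open>bounded S\<close> by (simp add: compact_closure)
  then have "compact (deriv f ` closure S)"
    by (intro compact_continuous_image continuous_on_subset[OF cont]) auto
  then obtain C where C: "\<And>z. z \<in> S \<Longrightarrow> cmod (deriv f z) \<le> C"
    by (metis bounded_iff closure_subset compact_imp_bounded image_eqI subsetD)
  have int_eq: "(\<integral>\<^sup>+z. ennreal ((cmod (deriv f z))\<^sup>2) * indicator S z \<partial>lborel) =
      (\<integral>\<^sup>+x. ennreal (indicator S' x * J x) \<partial>lborel)"
    by (subst lborel_complex_eq_distr, subst nn_integral_distr)
       (auto intro!: nn_integral_cong simp: J_def S'_def split: split_indicator)
  have "(\<integral>\<^sup>+x. ennreal (indicator S' x * J x) \<partial>lborel) \<le> (\<integral>\<^sup>+x. ennreal (C\<^sup>2) * indicator S' x \<partial>lborel)"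
    using C by (intro nn_integral_mono)
      (auto simp: J_def S'_def split: split_indicator intro!: power_mono)
  also have "\<dots> < \<infinity>"
    using emeasure_bounded_finite[OF \<open>bounded S'\<close>]
    by (simp add: nn_integral_cmult_indicator ennreal_mult_less_top)
  finally have "(\<integral>\<^sup>+x. ennreal (indicator S' x * J x) \<partial>lborel) < \<infinity>" .
  then obtain m where m: "(\<integral>\<^sup>+x. ennreal (indicator S' x * J x) \<partial>lborel) = ennreal m" "m \<ge> 0"
    by (intro that[of "enn2real (\<integral>\<^sup>+x. ennreal (indicator S' x * J x) \<partial>lborel)"]) simp_all
  have "((\<lambda>x. indicator S' x * J x) has_integral m) UNIV"
    by (rule nn_integral_has_integral) (use m in \<open>auto simp: J_def\<close>)
  moreover have "(\<lambda>x. indicator S' x * J x) = (\<lambda>x. if x \<in> S' then J x else 0)"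
    by (auto simp: indicator_def)
  ultimately have "(J has_integral m) S'"
    by (simp add: has_integral_restrict_UNIV)
  then have hi: "((\<lambda>x. \<bar>det (matrix (\<lambda>h. vec_of_complex (deriv f (complex_of_vec x) * complex_of_vec h)))\<bar>)
      has_integral m) S'"
    by (simp add: det_matrix_complex_mult J_def)
  have der: "(F has_derivative (\<lambda>h. vec_of_complex (deriv f (complex_of_vec x) * complex_of_vec h)))
     (at x within S')" for x
  proof -
    have "(f has_derivative (\<lambda>h. deriv f (complex_of_vec x) * h)) (at (complex_of_vec x))"
      using holomorphic_derivI[OF hol] by (auto simp: has_field_derivative_def)
    then have "((\<lambda>x. vec_of_complex (f (complex_of_vec x))) has_derivative
        (\<lambda>h. vec_of_complex (deriv f (complex_of_vec x) * complex_of_vec h))) (at x)"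
      by (intro bounded_linear.has_derivative[OF bounded_linear_vec_of_complex]
          has_derivative_compose[OF bounded_linear_imp_has_derivative[OF bounded_linear_complex_of_vec]])
    then show ?thesis by (simp add: F_def o_def has_derivative_at_withinI)
  qed
  have injF: "inj_on F S'"
  proof (rule inj_onI)
    fix x y assume xy: "x \<in> S'" "y \<in> S'" "F x = F y"
    then have "complex_of_vec (F x) = complex_of_vec (F y)" by simp
    then have "f (complex_of_vec x) = f (complex_of_vec y)" by (simp add: F_def)
    then have "complex_of_vec x = complex_of_vec y"
      using inj xy by (auto simp: S'_def inj_on_def)
    then have "vec_of_complex (complex_of_vec x) = vec_of_complex (complex_of_vec y)" by simp
    then show "x = y" by simp
  qed
  have FS: "F ` S' = complex_of_vec -` (f ` S)"
  proof (intro subset_antisym subsetI)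
    fix x assume "x \<in> complex_of_vec -` (f ` S)"
    then obtain z where z: "z \<in> S" "complex_of_vec x = f z" by auto
    then have "x = F (vec_of_complex z)" by (simp add: F_def flip: z(2))
    then show "x \<in> F ` S'" using z by (simp add: S'_def)
  qed (auto simp: F_def S'_def)
  have lm: "F ` S' \<in> lmeasurable \<and> measure lebesgue (F ` S') = m"
    using has_measure_differentiable_image[OF _ der injF] hi by auto
  then have "emeasure lebesgue (F ` S') = ennreal m"
    by (metis emeasure_eq_measure2)
  moreover have [measurable]: "F ` S' \<in> sets borel"
    unfolding FS using measurable_sets[OF borel_measurable_complex_of_vec img] by simp
  ultimately have "emeasure lborel (F ` S') = ennreal m"
    by simp
  then have "emeasure lborel (f ` S) = ennreal m"
    by (subst lborel_complex_eq_distr) (simp add: emeasure_distr img flip: FS)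
  then show ?thesis
    using int_eq m by simp
qed

text \<open>The inverse of an injective holomorphic function is holomorphic on its open image; hence \<open>f ` D\<close>
  is the preimage of \<open>D\<close> under a Borel function.\<close>
lemma borel_holomorphic_injective_image:
  fixes f :: "complex \<Rightarrow> complex"
  assumes "f holomorphic_on S" "open S" "inj_on f S" "D \<subseteq> S" and D [measurable]: "D \<in> sets borel"
  shows "f ` D \<in> sets borel"
proof -
  obtain g where g: "g holomorphic_on f ` S" "\<And>z. z \<in> S \<Longrightarrow> g (f z) = z"
    using holomorphic_has_inverse[OF assms(1-3)] by metis
  have op: "open (f ` S)"
    by (rule open_mapping_thm3) fact+
  have "(\<lambda>w. if w \<in> f ` S then g w else 0) \<in> borel_measurable borel"
    using op by (intro borel_measurable_continuous_on_if continuous_on_const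
        holomorphic_on_imp_continuous_on g) auto
  from measurable_sets[OF this D]
  have "f ` S \<inter> (\<lambda>w. if w \<in> f ` S then g w else 0) -` D \<in> sets borel"
    using op by auto
  also have "f ` S \<inter> (\<lambda>w. if w \<in> f ` S then g w else 0) -` D = f ` D"
    using g(2) assms(4) by auto
  finally show ?thesis .
qed

text \<open>On Borel sets this says that Lebesgue measure restricted to \<open>f ` D\<close> is the push-forward of
  \<open>\<bar>f'\<bar>\<^sup>2\<close> times Lebesgue measure on \<open>D\<close>; equality of the two measures then gives the claim for all
  Borel functions.\<close>
lemma nn_integral_holomorphic_injective:
  fixes f :: "complex \<Rightarrow> complex" and g :: "complex \<Rightarrow> ennreal"
  assumes hol: "f holomorphic_on UNIV" and S: "open S" "bounded S" "inj_on f S"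
    and D: "D \<subseteq> S" and [measurable]: "D \<in> sets borel" "g \<in> borel_measurable borel"
  shows "f ` D \<in> sets borel"
    and "(\<integral>\<^sup>+w. g w * indicator (f ` D) w \<partial>lborel) =
         (\<integral>\<^sup>+z. ennreal ((cmod (deriv f z))\<^sup>2) * g (f z) * indicator D z \<partial>lborel)"
proof -
  have img: "f ` A \<in> sets borel" if "A \<subseteq> D" "A \<in> sets borel" for A
    using that D by (intro borel_holomorphic_injective_image[OF holomorphic_on_subset[OF hol] S(1,3)]) auto
  then show [measurable]: "f ` D \<in> sets borel" by simp
  have [measurable]: "f \<in> borel_measurable borel"
    by (intro borel_measurable_continuous_onI holomorphic_on_imp_continuous_on hol)
  have "continuous_on UNIV (deriv f)"
    by (intro holomorphic_on_imp_continuous_on holomorphic_deriv hol) simp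
  then have [measurable]: "deriv f \<in> borel_measurable borel"
    by (rule borel_measurable_continuous_onI)
  have "density lborel (indicator (f ` D)) =
    distr (density lborel (\<lambda>z. ennreal ((cmod (deriv f z))\<^sup>2) * indicator D z)) borel f" (is "?L = ?R")
  proof (rule measure_eqI)
    fix A assume "A \<in> sets ?L"
    then have [measurable]: "A \<in> sets borel" by simp
    have [measurable]: "D \<inter> f -` A \<in> sets borel"
      using measurable_sets[of f borel borel A] by simp
    have "emeasure ?R A =
        (\<integral>\<^sup>+z. ennreal ((cmod (deriv f z))\<^sup>2) * indicator (D \<inter> f -` A) z \<partial>lborel)"
      using measurable_sets[of f borel borel A]
      by (simp add: emeasure_distr emeasure_density)
         (auto intro!: nn_integral_cong split: split_indicator)
    also have "\<dots> = emeasure lborel (f ` (D \<inter> f -` A))"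
      using D S by (intro emeasure_holomorphic_image[symmetric] hol img)
        (auto intro: bounded_subset inj_on_subset)
    also have "f ` (D \<inter> f -` A) = f ` D \<inter> A" by auto
    also have "emeasure lborel (f ` D \<inter> A) = emeasure ?L A"
      by (simp add: emeasure_density indicator_inter_arith[symmetric] nn_integral_indicator)
    finally show "emeasure ?L A = emeasure ?R A" by simp
  qed simp
  then have "integral\<^sup>N ?L g = integral\<^sup>N ?R g" by simp
  then show "(\<integral>\<^sup>+w. g w * indicator (f ` D) w \<partial>lborel) =
         (\<integral>\<^sup>+z. ennreal ((cmod (deriv f z))\<^sup>2) * g (f z) * indicator D z \<partial>lborel)"
    by (simp add: nn_integral_density nn_integral_distr mult_ac)
qed

lemma deriv_poly_eq: "deriv (poly p) z = poly (pderiv p) (z :: complex)"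
  by (rule DERIV_imp_deriv) (rule poly_DERIV)

text \<open>Away from the finitely many critical points, \<open>p\<close> is locally injective, so countably many balls
  on which \<open>p\<close> is injective cover the rest of \<open>\<Theta>\<close>. Made disjoint, they yield pieces \<open>D i\<close> whose
  images cover \<open>w\<close> as often as \<open>w\<close> has preimages in \<open>\<Theta>\<close>, except when \<open>w\<close> is a critical value. For
  constant \<open>p\<close> both sides vanish: the only value taken is a single point.\<close>
lemma area_formula_poly:
  fixes p :: "complex poly" and g :: "complex \<Rightarrow> ennreal"
  assumes "open \<Theta>" and [measurable]: "g \<in> borel_measurable borel"
  shows "(\<integral>\<^sup>+w. g w * of_nat (card {z \<in> \<Theta>. poly p z = w}) \<partial>lborel) =
         (\<integral>\<^sup>+z. ennreal ((cmod (poly (pderiv p) z))\<^sup>2) * g (poly p z) * indicator \<Theta> z \<partial>lborel)"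
proof (cases "degree p = 0")
  case True
  then obtain c where p: "p = [:c:]" by (rule degree_eq_zeroE)
  have "AE w in lborel. w \<noteq> c" by (rule AE_lborel_singleton)
  then have "(\<integral>\<^sup>+w. g w * of_nat (card {z \<in> \<Theta>. poly p z = w}) \<partial>lborel) = (\<integral>\<^sup>+w. 0 \<partial>(lborel :: complex measure))"
    by (intro nn_integral_cong_AE) (auto simp: p)
  then show ?thesis by (simp add: p)
next
  case False
  define Z where "Z = {z. poly (pderiv p) z = 0}"
  have "pderiv p \<noteq> 0" using False by (simp add: pderiv_eq_0_iff)
  then have finZ: "finite Z" unfolding Z_def by (rule poly_roots_finite)
  define U where "U = \<Theta> - Z"
  have "open U" unfolding U_def using assms(1) finZ by (intro open_Diff finite_imp_closed)
  have hol: "poly p holomorphic_on A" for A by (intro holomorphic_intros)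
  \<comment> \<open>The empty set is added because an enumeration by natural numbers needs a nonempty family.\<close>
  define \<F> where "\<F> = insert {} {ball \<xi> r | \<xi> r. ball \<xi> r \<subseteq> U \<and> inj_on (poly p) (ball \<xi> r)}"
  have "\<Union>\<F> = U"
  proof (rule subset_antisym)
    show "U \<subseteq> \<Union>\<F>"
    proof
      fix \<xi> assume \<xi>: "\<xi> \<in> U"
      then have "deriv (poly p) \<xi> \<noteq> 0" by (simp add: U_def Z_def deriv_poly_eq)
      then obtain r where "r > 0" "ball \<xi> r \<subseteq> U" "inj_on (poly p) (ball \<xi> r)"
        using has_complex_derivative_locally_injective[OF hol \<xi> \<open>open U\<close>] by blast
      then show "\<xi> \<in> \<Union>\<F>" unfolding \<F>_def
        by (intro UnionI[of "ball \<xi> r"]) auto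
    qed
  qed (auto simp: \<F>_def)
  moreover have "\<And>S. S \<in> \<F> \<Longrightarrow> open S" by (auto simp: \<F>_def)
  ultimately obtain \<F>' where \<F>': "\<F>' \<subseteq> \<F>" "countable \<F>'" "\<Union>\<F>' = U"
    using Lindelof[of \<F>] by metis
  define B where "B = from_nat_into (insert {} \<F>')"
  have rB: "range B = insert {} \<F>'"
    unfolding B_def using \<F>' by (intro range_from_nat_into) auto
  have B: "open (B i)" "bounded (B i)" "inj_on (poly p) (B i)" for i
  proof -
    have "B i \<in> \<F>" using rB \<F>'(1) by (auto simp: \<F>_def)
    then show "open (B i)" "bounded (B i)" "inj_on (poly p) (B i)" by (auto simp: \<F>_def)
  qed
  have UB: "(\<Union>i. B i) = U" using rB \<F>' by auto
  define D where "D = disjointed B"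
  have DB: "D i \<subseteq> B i" for i unfolding D_def by (rule disjointed_subset)
  have DU: "(\<Union>i. D i) = U" unfolding D_def UB[symmetric] by (rule UN_disjointed_eq)
  have Ddisj: "disjoint_family D" unfolding D_def by (rule disjoint_family_disjointed)
  have [measurable]: "D i \<in> sets borel" for i
    unfolding D_def disjointed_def using B by auto
  have [measurable]: "poly p \<in> borel_measurable borel" "poly (pderiv p) \<in> borel_measurable borel"
    by (auto intro!: borel_measurable_continuous_onI continuous_intros)
  note inj = nn_integral_holomorphic_injective[OF hol B(1,2,3) DB]
  have [measurable]: "poly p ` D i \<in> sets borel" for i
    by (rule inj) measurable
  have card_eq: "of_nat (card {z \<in> \<Theta>. poly p z = w}) = (\<Sum>i. indicator (poly p ` D i) w :: ennreal)"
    if "w \<notin> poly p ` Z" for w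
  proof -
    define A where "A = {z \<in> \<Theta>. poly p z = w}"
    have "p \<noteq> [:w:]" using False by auto
    then have "p - [:w:] \<noteq> 0" by simp
    then have "finite {z. poly (p - [:w:]) z = 0}" by (rule poly_roots_finite)
    then have fin: "finite A" unfolding A_def by (rule rev_finite_subset) auto
    have "A = (\<Union>i. A \<inter> D i)" using that DU by (auto simp: A_def U_def)
    then have "emeasure (count_space UNIV) A = emeasure (count_space UNIV) (\<Union>i. A \<inter> D i)"
      by simp
    also have "\<dots> = (\<Sum>i. emeasure (count_space UNIV) (A \<inter> D i))"
      using Ddisj by (intro suminf_emeasure[symmetric]) (auto simp: disjoint_family_on_def)
    also have "\<dots> = (\<Sum>i. indicator (poly p ` D i) w)"
    proof (rule suminf_cong)
      fix i
      show "emeasure (count_space UNIV) (A \<inter> D i) = (indicator (poly p ` D i) w :: ennreal)"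
      proof (cases "w \<in> poly p ` D i")
        case True
        then obtain z where z: "z \<in> D i" "w = poly p z" by auto
        have "inj_on (poly p) (D i)" using B(3) DB by (rule inj_on_subset)
        moreover have "D i \<subseteq> \<Theta>" using DU by (auto simp: U_def)
        ultimately have "A \<inter> D i = {z}" using z by (auto simp: A_def inj_on_def)
        then show ?thesis using True by simp
      next
        case False
        then have "A \<inter> D i = {}" by (auto simp: A_def)
        then show ?thesis using False by simp
      qed
    qed
    finally show ?thesis using fin by (simp add: A_def)
  qed
  have "AE w in lborel. w \<notin> poly p ` Z"
    using finZ by (intro AE_not_in countable_imp_null_set_lborel countable_finite finite_imageI)
  then have "(\<integral>\<^sup>+w. g w * of_nat (card {z \<in> \<Theta>. poly p z = w}) \<partial>lborel) =
      (\<integral>\<^sup>+w. (\<Sum>i. g w * indicator (poly p ` D i) w) \<partial>lborel)"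
    by (intro nn_integral_cong_AE) (auto simp: card_eq)
  also have "\<dots> = (\<Sum>i. \<integral>\<^sup>+w. g w * indicator (poly p ` D i) w \<partial>lborel)"
    by (rule nn_integral_suminf) measurable
  also have "\<dots> = (\<Sum>i. \<integral>\<^sup>+z. ennreal ((cmod (poly (pderiv p) z))\<^sup>2) * g (poly p z) * indicator (D i) z \<partial>lborel)"
    by (intro suminf_cong) (subst inj, measurable, simp add: deriv_poly_eq)
  also have "\<dots> = (\<integral>\<^sup>+z. (\<Sum>i. ennreal ((cmod (poly (pderiv p) z))\<^sup>2) * g (poly p z) * indicator (D i) z) \<partial>lborel)"
    by (rule nn_integral_suminf[symmetric]) measurable
  \<comment> \<open>The critical points contribute nothing, since the factor \<open>\<bar>p'\<bar>\<^sup>2\<close> vanishes there.\<close>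
  also have "\<dots> = (\<integral>\<^sup>+z. ennreal ((cmod (poly (pderiv p) z))\<^sup>2) * g (poly p z) * indicator \<Theta> z \<partial>lborel)"
  proof (rule nn_integral_cong)
    fix z
    have "(\<Sum>i. indicator (D i) z) = (indicator U z :: ennreal)"
      using suminf_indicator[OF Ddisj] DU by simp
    then show "(\<Sum>i. ennreal ((cmod (poly (pderiv p) z))\<^sup>2) * g (poly p z) * indicator (D i) z) =
        ennreal ((cmod (poly (pderiv p) z))\<^sup>2) * g (poly p z) * indicator \<Theta> z"
      by (auto simp: U_def Z_def split: split_indicator)
  qed
  finally show ?thesis .
qed

section \<open>Measurability of the root count\<close>

lemma closed_image_snd_of_compact_fst:
  fixes T :: "('a::metric_space \<times> 'b::metric_space) set"
  assumes "compact K" "closed T"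
  shows "closed {y. \<exists>x\<in>K. (x, y) \<in> T}"
  unfolding closed_sequential_limits
proof (intro allI impI, elim conjE)
  fix y l assume y: "\<forall>n. y n \<in> {y. \<exists>x\<in>K. (x, y) \<in> T}" and lim: "y \<longlonglongrightarrow> l"
  then obtain x where x: "\<And>n. x n \<in> K" "\<And>n. (x n, y n) \<in> T"
    by (simp add: Bex_def) metis
  then obtain r k where r: "k \<in> K" "strict_mono r" "(x \<circ> r) \<longlonglongrightarrow> k"
    using assms(1) unfolding compact_def by metis
  have "(\<lambda>n. ((x \<circ> r) n, (y \<circ> r) n)) \<longlonglongrightarrow> (k, l)"
    by (intro tendsto_Pair r LIMSEQ_subseq_LIMSEQ[OF lim])
  moreover have "((x \<circ> r) n, (y \<circ> r) n) \<in> T" for n using x by simp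
  ultimately have "(k, l) \<in> T"
    by (rule closed_sequentially[OF assms(2), rotated])
  then show "l \<in> {y. \<exists>x\<in>K. (x, y) \<in> T}" using r by blast
qed

text \<open>The entries up to index \<open>N\<close> are read as the coefficients of a polynomial, from which \<open>k\<close> linear
  factors with roots in \<open>K\<close> can be split off in succession: a root \<open>z\<close> is chosen, and the second condition
  recurses on the coefficients of the quotient by \<open>X - z\<close>, given by synthetic division. Working with
  sequences rather than polynomials makes the product topology available.\<close>
primrec at_least_roots :: "nat \<Rightarrow> complex set \<Rightarrow> nat \<Rightarrow> (nat \<Rightarrow> complex) set" where
  "at_least_roots N K 0 = UNIV"
| "at_least_roots N K (Suc k) =
     {c. \<exists>z\<in>K. (\<Sum>i\<le>N. c i * z ^ i) = 0 \<and>
        (\<lambda>i. \<Sum>j\<in>{i<..N}. c j * z ^ (j - Suc i)) \<in> at_least_roots N K k}"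

text \<open>The value at \<open>z\<close> and the coefficients of the quotient depend continuously on \<open>z\<close> and the
  sequence, and the existential quantifier over the compact set \<open>K\<close> preserves closedness. This
  expresses the upper semicontinuity of the number of roots in \<open>K\<close>.\<close>
lemma closed_at_least_roots:
  assumes "compact K"
  shows "closed (at_least_roots N K k)"
proof (induction k)
  case (Suc k)
  define F where "F = (\<lambda>(z::complex, c::nat \<Rightarrow> complex). \<Sum>i\<le>N. c i * z ^ i)"
  define G where "G = (\<lambda>(z::complex, c::nat \<Rightarrow> complex). \<lambda>i. \<Sum>j\<in>{i<..N}. c j * z ^ (j - Suc i))"
  have coord: "continuous_on UNIV (\<lambda>x. (snd x :: nat \<Rightarrow> complex) i)" for i
    by (rule continuous_on_product_then_coordinatewise) (intro continuous_intros)
  have "continuous_on UNIV F" "continuous_on UNIV G"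
    unfolding F_def G_def case_prod_unfold
    by (intro continuous_intros continuous_on_coordinatewise_then_product coord)+
  then have "closed (F -` {0} \<inter> G -` at_least_roots N K k)"
    using Suc.IH by (intro closed_Int closed_vimage) auto
  from closed_image_snd_of_compact_fst[OF assms this]
  show ?case by (simp add: F_def G_def)
qed simp

lemma at_least_roots_mono: "K \<subseteq> L \<Longrightarrow> at_least_roots N K k \<subseteq> at_least_roots N L k"
  by (induction k) (simp, fastforce)

lemma at_least_roots_incseq_Union:
  assumes "incseq K"
  shows "at_least_roots N (\<Union>m. K m) k = (\<Union>m. at_least_roots N (K m) k)"
proof (rule subset_antisym)
  show "at_least_roots N (\<Union>m. K m) k \<subseteq> (\<Union>m. at_least_roots N (K m) k)"
  proof (induction k)
    case (Suc k)
    show ?case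
    proof
      fix c assume "c \<in> at_least_roots N (\<Union>m. K m) (Suc k)"
      then obtain z m where z: "z \<in> K m" "(\<Sum>i\<le>N. c i * z ^ i) = 0"
        "(\<lambda>i. \<Sum>j\<in>{i<..N}. c j * z ^ (j - Suc i)) \<in> at_least_roots N (\<Union>m. K m) k"
        by auto
      with Suc.IH obtain m' where
        "(\<lambda>i. \<Sum>j\<in>{i<..N}. c j * z ^ (j - Suc i)) \<in> at_least_roots N (K m') k" by blast
      then have "(\<lambda>i. \<Sum>j\<in>{i<..N}. c j * z ^ (j - Suc i)) \<in> at_least_roots N (K (max m m')) k"
        using at_least_roots_mono[of "K m'" "K (max m m')"] incseqD[OF assms, of m' "max m m'"] by auto
      moreover have "z \<in> K (max m m')"
        using z(1) incseqD[OF assms, of m "max m m'"] by auto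
      ultimately have "c \<in> at_least_roots N (K (max m m')) (Suc k)" using z(2) by auto
      then show "c \<in> (\<Union>m. at_least_roots N (K m) (Suc k))" by blast
    qed
  qed simp
  show "(\<Union>m. at_least_roots N (K m) k) \<subseteq> at_least_roots N (\<Union>m. K m) k"
    by (intro UN_least at_least_roots_mono UN_upper) simp
qed

text \<open>Finitely many roots in an open set already lie in one member of an increasing compact
  exhaustion, so the set is a countable union of closed sets.\<close>
lemma borel_at_least_roots_open:
  assumes "open \<Theta>"
  shows "at_least_roots N \<Theta> k \<in> sets borel"
proof -
  obtain K where K: "\<And>m. compact (K m)" "\<And>m. K m \<subseteq> \<Theta>" "\<And>m. K m \<subseteq> interior (K (Suc m))" "\<Union>(range K) = \<Theta>"
    using open_Union_compact_subsets[OF assms] by metis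
  have "incseq K"
    using K(3) interior_subset by (intro incseq_SucI) blast
  then have "at_least_roots N \<Theta> k = (\<Union>m. at_least_roots N (K m) k)"
    using at_least_roots_incseq_Union[of K] K(4) by simp
  moreover have "at_least_roots N (K m) k \<in> sets borel" for m
    using K(1) by (intro borel_closed closed_at_least_roots)
  ultimately show ?thesis by simp
qed

lemma poly_eq_sum_atMost:
  fixes p :: "'a::comm_semiring_1 poly"
  assumes "degree p \<le> N"
  shows "poly p z = (\<Sum>i\<le>N. coeff p i * z ^ i)"
  unfolding poly_altdef using assms
  by (intro sum.mono_neutral_left) (auto simp: coeff_eq_0)

lemma coeff_synthetic_div:
  fixes p :: "'a::comm_ring_1 poly"
  assumes "degree p \<le> N"
  shows "coeff (synthetic_div p z) i = (\<Sum>j\<in>{i<..N}. coeff p j * z ^ (j - Suc i))"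
proof (cases "i \<le> N")
  case False
  then have "coeff (synthetic_div p z) i = 0"
    using assms by (intro coeff_eq_0) (simp add: degree_synthetic_div)
  then show ?thesis using False by simp
next
  case True
  then show ?thesis
  proof (induction i rule: inc_induct)
    case base
    have "coeff (pCons (poly p z) (synthetic_div p z)) (Suc N) = 0"
      using assms synthetic_div_correct[of p z, symmetric]
      by (simp add: coeff_eq_0 degree_synthetic_div)
    then show ?case by simp
  next
    case (step i)
    have "coeff (pCons (poly p z) (synthetic_div p z)) (Suc i) =
        coeff (p + smult z (synthetic_div p z)) (Suc i)"
      by (simp add: synthetic_div_correct)
    then have "coeff (synthetic_div p z) i = coeff p (Suc i) + z * coeff (synthetic_div p z) (Suc i)"
      by simp
    also have "\<dots> = coeff p (Suc i) + (\<Sum>j\<in>{Suc i<..N}. coeff p j * z ^ (j - Suc i))"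
    proof -
      have "z * (coeff p j * z ^ (j - Suc (Suc i))) = coeff p j * z ^ (j - Suc i)"
        if "j \<in> {Suc i<..N}" for j
      proof -
        have "j - Suc i = Suc (j - Suc (Suc i))" using that by auto
        then show ?thesis by simp
      qed
      then show ?thesis
        unfolding step.IH sum_distrib_left
        by (intro arg_cong2[where f="(+)"] sum.cong refl)
    qed
    also have "\<dots> = (\<Sum>j\<in>insert (Suc i) {Suc i<..N}. coeff p j * z ^ (j - Suc i))"
      by simp
    also have "insert (Suc i) {Suc i<..N} = {i<..N}" using step.hyps by auto
    finally show ?case .
  qed
qed

text \<open>Splitting off a root removes one occurrence of it from the multiset of roots, so that \<open>k\<close>
  successive choices count roots with multiplicity. The zero polynomial has to be excluded: its
  multiset of roots is empty by convention, although every point is a root.\<close>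
lemma coeff_in_at_least_roots_iff:
  assumes "degree p \<le> N" "p \<noteq> 0"
  shows "coeff p \<in> at_least_roots N K k \<longleftrightarrow> k \<le> size (filter_mset (\<lambda>z. z \<in> K) (proots p))"
  using assms
proof (induction k arbitrary: p)
  case (Suc k)
  have step: "(\<lambda>i. \<Sum>j\<in>{i<..N}. coeff p j * z ^ (j - Suc i)) \<in> at_least_roots N K k \<longleftrightarrow>
      Suc k \<le> size (filter_mset (\<lambda>z. z \<in> K) (proots p))" if z: "z \<in> K" "poly p z = 0" for z
  proof -
    define q where "q = synthetic_div p z"
    have p: "p = [:-z, 1:] * q"
      using synthetic_div_correct'[of z p] z(2) by (simp add: q_def)
    have "q \<noteq> 0" using p Suc.prems by auto
    then have pr: "proots p = {#z#} + proots q"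
      unfolding p by (subst proots_mult) auto
    have "degree q \<le> N" using Suc.prems by (simp add: q_def degree_synthetic_div)
    have "(\<lambda>i. \<Sum>j\<in>{i<..N}. coeff p j * z ^ (j - Suc i)) = coeff q"
      by (simp add: q_def coeff_synthetic_div[OF Suc.prems(1)] fun_eq_iff)
    then show ?thesis
      using Suc.IH[OF \<open>degree q \<le> N\<close> \<open>q \<noteq> 0\<close>] z(1) by (simp add: pr)
  qed
  have "\<exists>z\<in>K. poly p z = 0" if "Suc k \<le> size (filter_mset (\<lambda>z. z \<in> K) (proots p))"
  proof -
    have "filter_mset (\<lambda>z. z \<in> K) (proots p) \<noteq> {#}"
    proof
      assume "filter_mset (\<lambda>z. z \<in> K) (proots p) = {#}"
      then show False using that by (simp only: size_empty not_less_eq_eq le0 Suc_le_eq) simp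
    qed
    then obtain z where "z \<in># filter_mset (\<lambda>z. z \<in> K) (proots p)"
      using multiset_nonemptyE by blast
    then show ?thesis using Suc.prems by auto
  qed
  then show ?case
    using step by (auto simp flip: poly_eq_sum_atMost[OF Suc.prems(1)])
qed simp

lemma root_count_eq_size_proots:
  assumes "p \<noteq> [:v:]"
  shows "root_count \<Theta> p v = size (filter_mset (\<lambda>z. z \<in> \<Theta>) (proots (p - [:v:])))"
proof -
  have "p - [:v:] \<noteq> 0" using assms by simp
  then show ?thesis
    unfolding root_count_def size_multiset_overloaded_eq
    by (intro sum.cong) auto
qed

text \<open>A nonempty open set is infinite, and a sum over an infinite set is \<open>0\<close>.\<close>
lemma root_count_const_eq_0: "open \<Theta> \<Longrightarrow> root_count \<Theta> [:v:] v = 0"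
proof (cases "\<Theta> = {}")
  case False
  assume "open \<Theta>"
  then have "infinite \<Theta>" using finite_imp_not_open[of \<Theta>] False by blast
  then show ?thesis by (simp add: root_count_def)
qed (simp add: root_count_def)

lemma root_count_le_degree:
  assumes "open \<Theta>" "degree p \<le> N"
  shows "root_count \<Theta> p v \<le> N"
proof (cases "p = [:v:]")
  case False
  have "size (filter_mset (\<lambda>z. z \<in> \<Theta>) (proots (p - [:v:]))) \<le> size (proots (p - [:v:]))"
    by (intro size_mset_mono multiset_filter_subset)
  also have "\<dots> \<le> degree (p - [:v:])" by (rule size_proots_le)
  also have "\<dots> \<le> N" using assms(2) by (intro degree_diff_le) auto
  finally show ?thesis using False by (simp add: root_count_eq_size_proots)
qed (use assms root_count_const_eq_0 in simp)

lemma measurable_root_count: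
  assumes "open \<Theta>" and deg: "\<And>x. x \<in> space M \<Longrightarrow> degree (P x) \<le> N"
    and [measurable]: "\<And>i. (\<lambda>x. coeff (P x) i) \<in> borel_measurable M"
  shows "(\<lambda>x. root_count \<Theta> (P x) v) \<in> measurable M (count_space UNIV)"
proof -
  define Q where "Q = (\<lambda>x. P x - [:v:])"
  have [measurable]: "(\<lambda>x. coeff (Q x) i) \<in> borel_measurable M" for i
    unfolding Q_def coeff_diff by measurable
  have coeffs [measurable]: "(\<lambda>x. coeff (Q x)) \<in> borel_measurable M"
    by (rule measurable_coordinatewise_then_product) measurable
  have Q0: "Q x = 0 \<longleftrightarrow> (\<forall>i. coeff (Q x) i = 0)" for x
    by (auto simp: poly_eq_iff)
  have ge: "{x \<in> space M. k \<le> root_count \<Theta> (P x) v} \<in> sets M" for k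
  proof (cases "k = 0")
    case False
    have "{x \<in> space M. k \<le> root_count \<Theta> (P x) v} =
      {x \<in> space M. \<not> (\<forall>i. coeff (Q x) i = 0)} \<inter> ((\<lambda>x. coeff (Q x)) -` at_least_roots N \<Theta> k \<inter> space M)"
    proof -
      have "k \<le> root_count \<Theta> (P x) v \<longleftrightarrow> Q x \<noteq> 0 \<and> coeff (Q x) \<in> at_least_roots N \<Theta> k"
        if "x \<in> space M" for x
      proof (cases "Q x = 0")
        case True
        then have "P x = [:v:]" by (simp add: Q_def)
        then show ?thesis using False True assms(1) root_count_const_eq_0 by simp
      next
        case False
        then have "P x \<noteq> [:v:]" by (simp add: Q_def)
        moreover have "degree (Q x) \<le> N"
          unfolding Q_def using deg[OF that] by (intro degree_diff_le) auto
        ultimately show ?thesis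
          using coeff_in_at_least_roots_iff[of "Q x" N \<Theta> k] False
          by (simp add: root_count_eq_size_proots Q_def)
      qed
      then show ?thesis unfolding Q0 by auto
    qed
    also have "\<dots> \<in> sets M"
      by (intro sets.Int measurable_sets[OF coeffs] borel_at_least_roots_open assms(1)) measurable
    finally show ?thesis .
  qed simp
  have "(\<lambda>x. root_count \<Theta> (P x) v) -` {k} \<inter> space M =
      {x \<in> space M. k \<le> root_count \<Theta> (P x) v} - {x \<in> space M. Suc k \<le> root_count \<Theta> (P x) v}" for k
    by auto
  then show ?thesis
    using ge by (auto simp: measurable_count_space_eq2_countable)
qed

section \<open>The expected number of roots\<close>

text \<open>The density in the form in which it arises from the Gaussian integral. The index \<open>0\<close> is
  separated because \<open>\<phi> 0 = 1\<close> contributes exactly \<open>1\<close> to the kernel and nothing to its derivatives.\<close>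

lemma root_density_altdef:
  fixes \<phi> :: "nat \<Rightarrow> complex poly" and n :: nat
  assumes "\<phi> 0 = 1"
  defines "K \<equiv> \<lambda>z. 1 + (\<Sum>j\<in>{1..n}. (cmod (poly (\<phi> j) z))\<^sup>2)"
    and "B \<equiv> \<lambda>z. (\<Sum>j\<in>{1..n}. poly (pderiv (\<phi> j)) z * cnj (poly (\<phi> j) z))"
  shows "root_density n \<phi> v z = exp (- (cmod v)\<^sup>2 / K z) / (pi * K z) *
     ((cmod (v * (B z / of_real (K z))))\<^sup>2 +
      ((\<Sum>j\<in>{1..n}. (cmod (poly (pderiv (\<phi> j)) z))\<^sup>2) - (cmod (B z))\<^sup>2 / K z))"
proof -
  have split: "{..n} = insert 0 {1..n}" by auto
  have K: "K z > 0" unfolding K_def by (intro add_pos_nonneg sum_nonneg) auto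
  have k00: "Re (kernel n \<phi> 0 0 z z) = K z"
    unfolding kernel_diag K_def split by (simp add: assms(1))
  have k11: "Re (kernel n \<phi> 1 1 z z) = (\<Sum>j\<in>{1..n}. (cmod (poly (pderiv (\<phi> j)) z))\<^sup>2)"
    unfolding kernel_diag split by (simp add: assms(1))
  have "kernel n \<phi> 0 1 z z = cnj (B z)"
    unfolding kernel_def split B_def by (simp add: assms(1) mult.commute)
  then have k01: "cmod (kernel n \<phi> 0 1 z z) = cmod (B z)" by simp
  have "1 / pi * (s / k - b\<^sup>2 / k\<^sup>2 * (1 - u\<^sup>2 / k)) * e = e / (pi * k) * ((u * (b / k))\<^sup>2 + (s - b\<^sup>2 / k))"
    if "k > 0" for s k b u e :: real
    using that by (simp add: field_simps power2_eq_square)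
  from this[OF K] show ?thesis
    unfolding root_density_def Let_def k00 k11 k01 using K by (simp add: norm_mult norm_divide)
qed

text \<open>The difference in the second summand of the alternative form is a conditional variance.\<close>
lemma root_density_nonneg:
  assumes "\<phi> 0 = 1"
  shows "root_density n \<phi> v z \<ge> 0"
  unfolding root_density_altdef[of \<phi>, OF assms]
  using nn_integral_gaussian_linear_forms(1)[of "{1..n}" "\<lambda>j. poly (pderiv (\<phi> j)) z" "\<lambda>j. poly (\<phi> j) z"]
  by (intro mult_nonneg_nonneg divide_nonneg_nonneg add_nonneg_nonneg sum_nonneg zero_le_power2) auto

lemma borel_measurable_poly [measurable]:
  "(\<lambda>z. poly p z) \<in> borel_measurable borel" for p :: "complex poly"
  by (intro borel_measurable_continuous_onI continuous_intros)

lemma borel_measurable_root_density: "root_density n \<phi> v \<in> borel_measurable borel"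
proof -
  have [measurable]: "cnj \<in> borel_measurable borel"
    by (intro borel_measurable_continuous_onI continuous_intros)
  show ?thesis
    unfolding root_density_def[abs_def] kernel_def Let_def by measurable
qed

text \<open>A multiple root of \<open>y + q z = v\<close> is a critical point \<open>z\<close> of \<open>q\<close> with \<open>y = v - q z\<close>, which
  excludes only finitely many \<open>y\<close>. If \<open>q\<close> is constant, there are no roots at all for \<open>y\<close> other than
  \<open>v - q\<close>.\<close>
lemma root_count_eq_card_AE:
  fixes q :: "complex poly"
  shows "AE y in lborel. root_count \<Theta> ([:y:] + q) v = card {z \<in> \<Theta>. poly q z = v - y}"
proof (cases "degree q = 0")
  case True
  then obtain c where q: "q = [:c:]" by (rule degree_eq_zeroE)
  have "AE y in lborel. y \<noteq> v - c" by (rule AE_lborel_singleton)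
  then show ?thesis
    by (rule AE_mp) (auto simp: q root_count_def algebra_simps)
next
  case False
  then have "pderiv q \<noteq> 0" by (simp add: pderiv_eq_0_iff)
  then have "finite {z. poly (pderiv q) z = 0}" by (rule poly_roots_finite)
  then have "AE y in lborel. y \<notin> (\<lambda>z. v - poly q z) ` {z. poly (pderiv q) z = 0}"
    by (intro AE_not_in countable_imp_null_set_lborel countable_finite finite_imageI)
  then show ?thesis
  proof (rule AE_mp, intro AE_I2 impI)
    fix y assume y: "y \<notin> (\<lambda>z. v - poly q z) ` {z. poly (pderiv q) z = 0}"
    have "order z ([:y:] + q - [:v:]) = 1" if "poly ([:y:] + q) z = v" for z
    proof -
      define p where "p = [:y:] + q - [:v:]"
      have dp: "pderiv p = pderiv q" by (simp add: p_def pderiv_add pderiv_diff)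
      have "y = v - poly q z" using that by (simp add: algebra_simps)
      then have "poly (pderiv p) z \<noteq> 0" unfolding dp using y by blast
      then have "order z (pderiv p) = 0" by (rule order_0I)
      moreover have "pderiv p \<noteq> 0" using \<open>pderiv q \<noteq> 0\<close> dp by simp
      moreover from this have "p \<noteq> 0" by auto
      moreover have "poly p z = 0" using that by (simp add: p_def)
      ultimately show ?thesis
        unfolding p_def[symmetric] using order_pderiv[of p z] by (simp add: order_root)
    qed
    then have "root_count \<Theta> ([:y:] + q) v = card {z \<in> \<Theta>. poly ([:y:] + q) z = v}"
      unfolding root_count_def by simp
    also have "{z \<in> \<Theta>. poly ([:y:] + q) z = v} = {z \<in> \<Theta>. poly q z = v - y}"
      by (auto simp: algebra_simps)
    finally show "root_count \<Theta> ([:y:] + q) v = card {z \<in> \<Theta>. poly q z = v - y}" .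
  qed
qed

text \<open>For fixed \<open>q\<close> and random constant term \<open>y\<close>, the roots are the points at which the polynomial
  \<open>v - q\<close> takes the value \<open>y\<close>; the area formula turns the expected count into an integral over
  \<open>\<Theta>\<close>.\<close>
lemma nn_integral_root_count_shift:
  fixes q :: "complex poly"
  assumes "open \<Theta>"
  shows "(\<integral>\<^sup>+y. of_nat (root_count \<Theta> ([:y:] + q) v) \<partial>std_complex_normal_measure) =
    (\<integral>\<^sup>+z. ennreal (std_complex_normal_density (v - poly q z) * (cmod (poly (pderiv q) z))\<^sup>2)
        * indicator \<Theta> z \<partial>lborel)"
proof -
  have [measurable]: "(\<lambda>y. root_count \<Theta> ([:y:] + q) v) \<in> measurable borel (count_space UNIV)"
  proof (rule measurable_root_count[OF assms, where N = "degree q"])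
    show "(\<lambda>y. coeff ([:y:] + q) i) \<in> borel_measurable borel" for i
      by (cases i) simp_all
    show "degree ([:y:] + q) \<le> degree q" for y by (rule degree_add_le) simp_all
  qed
  have "(\<integral>\<^sup>+y. of_nat (root_count \<Theta> ([:y:] + q) v) \<partial>std_complex_normal_measure) =
      (\<integral>\<^sup>+y. ennreal (std_complex_normal_density y) * of_nat (root_count \<Theta> ([:y:] + q) v) \<partial>lborel)"
    by (rule nn_integral_std_complex_normal_measure) measurable
  also have "\<dots> = (\<integral>\<^sup>+y. ennreal (std_complex_normal_density y) *
      of_nat (card {z \<in> \<Theta>. poly ([:v:] - q) z = y}) \<partial>lborel)"
  proof (rule nn_integral_cong_AE, rule AE_mp[OF root_count_eq_card_AE[of \<Theta> q v]], intro AE_I2 impI)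
    fix y assume "root_count \<Theta> ([:y:] + q) v = card {z \<in> \<Theta>. poly q z = v - y}"
    moreover have "{z \<in> \<Theta>. poly q z = v - y} = {z \<in> \<Theta>. poly ([:v:] - q) z = y}"
      by (auto simp: algebra_simps)
    ultimately show "ennreal (std_complex_normal_density y) * of_nat (root_count \<Theta> ([:y:] + q) v) =
        ennreal (std_complex_normal_density y) * of_nat (card {z \<in> \<Theta>. poly ([:v:] - q) z = y})"
      by simp
  qed
  also have "\<dots> = (\<integral>\<^sup>+z. ennreal ((cmod (poly (pderiv ([:v:] - q)) z))\<^sup>2) *
      ennreal (std_complex_normal_density (poly ([:v:] - q) z)) * indicator \<Theta> z \<partial>lborel)"
    by (rule area_formula_poly[OF assms]) measurable
  also have "\<dots> = (\<integral>\<^sup>+z. ennreal (std_complex_normal_density (v - poly q z) * (cmod (poly (pderiv q) z))\<^sup>2)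
        * indicator \<Theta> z \<partial>lborel)"
    by (intro nn_integral_cong)
       (simp add: pderiv_diff ennreal_mult std_complex_normal_density_nonneg mult_ac)
  finally show ?thesis .
qed

text \<open>Integrating first over the coefficient of \<open>\<phi> 0 = 1\<close>, which is the constant term up to a shift,
  and exchanging the integrals over the other coefficients and over \<open>\<Theta>\<close> leaves the expectation of
  \<open>\<bar>q' z\<bar>\<^sup>2\<close> times a Gaussian density at \<open>v - q z\<close>, where \<open>q z\<close> and \<open>q' z\<close> are linear forms in the
  coefficients.\<close>
lemma nn_integral_root_count_PiM:
  fixes \<phi> :: "nat \<Rightarrow> complex poly"
  assumes "open \<Theta>" and "\<phi> 0 = 1" and deg: "\<And>j. j \<le> n \<Longrightarrow> degree (\<phi> j) = j"
  shows "(\<integral>\<^sup>+x. of_nat (root_count \<Theta> (\<Sum>j\<le>n. smult (x j) (\<phi> j)) v)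
            \<partial>PiM {..n} (\<lambda>_. std_complex_normal_measure)) =
         (\<integral>\<^sup>+z. ennreal (root_density n \<phi> v z) * indicator \<Theta> z \<partial>lborel)"
proof -
  let ?N = "std_complex_normal_measure"
  let ?P = "PiM {1..n} (\<lambda>_. ?N)"
  interpret product_sigma_finite "\<lambda>_::nat. ?N"
    by (rule product_sigma_finite_std_complex_normal)
  interpret P: prob_space ?P
    by (intro prob_space_PiM prob_space_std_complex_normal_measure)
  interpret pair_sigma_finite ?P "lborel :: complex measure" by standard
  define q where "q = (\<lambda>x. \<Sum>j\<in>{1..n}. smult (x j) (\<phi> j))"
  have split: "{..n} = insert 0 {1..n}" by auto
  have coord [measurable]: "(\<lambda>x. x j) \<in> borel_measurable (PiM {..n} (\<lambda>_. ?N))" if "j \<in> {..n}" for j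
    using that by (rule borel_measurable_coord_std_complex_normal)
  have "(\<lambda>x. root_count \<Theta> (\<Sum>j\<le>n. smult (x j) (\<phi> j)) v) \<in> measurable (PiM {..n} (\<lambda>_. ?N)) (count_space UNIV)"
    by (intro measurable_root_count[OF assms(1), where N = n])
       (auto simp: coeff_sum deg intro!: degree_sum_le order.trans[OF degree_smult_le])
  then have [measurable]: "(\<lambda>x. root_count \<Theta> (\<Sum>j\<in>insert 0 {1..n}. smult (x j) (\<phi> j)) v)
      \<in> measurable (PiM (insert 0 {1..n}) (\<lambda>_. ?N)) (count_space UNIV)"
    unfolding split .
  have "(\<integral>\<^sup>+x. of_nat (root_count \<Theta> (\<Sum>j\<le>n. smult (x j) (\<phi> j)) v) \<partial>PiM {..n} (\<lambda>_. ?N)) =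
     (\<integral>\<^sup>+x. \<integral>\<^sup>+y. of_nat (root_count \<Theta> (\<Sum>j\<in>insert 0 {1..n}. smult ((x(0 := y)) j) (\<phi> j)) v) \<partial>?N \<partial>?P)"
    unfolding split by (rule product_nn_integral_insert) (simp, simp, measurable)
  also have "(\<lambda>x y. \<Sum>j\<in>insert 0 {1..n}. smult ((x(0 := y)) j) (\<phi> j)) = (\<lambda>x y. [:y:] + q x)"
    by (auto simp: q_def assms(2) fun_eq_iff intro!: sum.cong)
  also have "(\<integral>\<^sup>+x. \<integral>\<^sup>+y. of_nat (root_count \<Theta> ([:y:] + q x) v) \<partial>?N \<partial>?P) =
     (\<integral>\<^sup>+x. \<integral>\<^sup>+z. ennreal (std_complex_normal_density (v - poly (q x) z) * (cmod (poly (pderiv (q x)) z))\<^sup>2)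
        * indicator \<Theta> z \<partial>lborel \<partial>?P)"
    by (simp only: nn_integral_root_count_shift[OF assms(1)])
  also have "\<dots> = (\<integral>\<^sup>+x. \<integral>\<^sup>+z. ennreal (std_complex_normal_density (v - (\<Sum>j\<in>{1..n}. x j * poly (\<phi> j) z)) *
        (cmod (0 + (\<Sum>j\<in>{1..n}. x j * poly (pderiv (\<phi> j)) z)))\<^sup>2) * indicator \<Theta> z \<partial>lborel \<partial>?P)"
    unfolding q_def by (simp add: poly_sum higher_pderiv_sum[of 1, simplified] pderiv_smult)
  also have "\<dots> = (\<integral>\<^sup>+z. \<integral>\<^sup>+x. ennreal (std_complex_normal_density (v - (\<Sum>j\<in>{1..n}. x j * poly (\<phi> j) z)) *
        (cmod (0 + (\<Sum>j\<in>{1..n}. x j * poly (pderiv (\<phi> j)) z)))\<^sup>2) * indicator \<Theta> z \<partial>?P \<partial>lborel)"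
  proof (rule Fubini'[symmetric])
    have [measurable]: "(\<lambda>w. \<Sum>j\<in>{1..n}. fst w j * poly (h j) (snd w)) \<in> borel_measurable (?P \<Otimes>\<^sub>M lborel)"
      for h :: "nat \<Rightarrow> complex poly"
      by (intro borel_measurable_sum borel_measurable_times
          measurable_compose[OF measurable_fst borel_measurable_coord_std_complex_normal]
          measurable_compose[OF measurable_snd]) auto
    have [measurable]: "\<Theta> \<in> sets borel" using assms(1) by simp
    show "(\<lambda>(x, z). ennreal (std_complex_normal_density (v - (\<Sum>j\<in>{1..n}. x j * poly (\<phi> j) z)) *
        (cmod (0 + (\<Sum>j\<in>{1..n}. x j * poly (pderiv (\<phi> j)) z)))\<^sup>2) * indicator \<Theta> z)
        \<in> borel_measurable (?P \<Otimes>\<^sub>M lborel)"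
      unfolding case_prod_unfold by measurable
  qed
  also have "\<dots> = (\<integral>\<^sup>+z. ennreal (root_density n \<phi> v z) * indicator \<Theta> z \<partial>lborel)"
  proof (rule nn_integral_cong)
    fix z
    have [measurable]: "(\<lambda>x. \<Sum>j\<in>{1..n}. x j * c j) \<in> borel_measurable ?P" for c :: "nat \<Rightarrow> complex"
      by (intro borel_measurable_sum borel_measurable_times borel_measurable_const
          borel_measurable_coord_std_complex_normal)
    show "(\<integral>\<^sup>+x. ennreal (std_complex_normal_density (v - (\<Sum>j\<in>{1..n}. x j * poly (\<phi> j) z)) *
        (cmod (0 + (\<Sum>j\<in>{1..n}. x j * poly (pderiv (\<phi> j)) z)))\<^sup>2) * indicator \<Theta> z \<partial>?P) =
        ennreal (root_density n \<phi> v z) * indicator \<Theta> z"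
      by (subst nn_integral_multc, measurable)
         (subst nn_integral_gaussian_linear_forms(2), simp,
          simp add: root_density_altdef[of \<phi>, OF assms(2)])
  qed
  finally show ?thesis .
qed

theorem theorem1p3:
  fixes M :: "'a measure"
    and n :: nat
    and \<phi> :: "nat \<Rightarrow> complex poly"
    and \<eta> :: "nat \<Rightarrow> 'a \<Rightarrow> complex"
    and v :: complex
    and \<Theta> :: "complex set"
  assumes "prob_space M"
    and "n \<ge> 1"
    and "\<And>j. j \<le> n \<Longrightarrow> degree (\<phi> j) = j"
    and "\<phi> 0 = 1"
    and "prob_space.indep_vars M (\<lambda>_. borel) \<eta> {..n}"
    and "\<And>j. j \<le> n \<Longrightarrow> std_complex_normal M (\<eta> j)"
    and "open \<Theta>" and "connected \<Theta>"
  shows "integrable M (\<lambda>\<omega>. real (root_count \<Theta> (random_poly n \<phi> \<eta> \<omega>) v))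
    \<and> set_integrable lborel \<Theta> (root_density n \<phi> v)
    \<and> prob_space.expectation M (\<lambda>\<omega>. real (root_count \<Theta> (random_poly n \<phi> \<eta> \<omega>) v))
        = (LINT z:\<Theta>|lborel. root_density n \<phi> v z)"
proof -
  let ?N = "std_complex_normal_measure"
  interpret prob_space M by fact
  have [measurable]: "\<Theta> \<in> sets borel" using \<open>open \<Theta>\<close> by simp
  note borel_measurable_root_density [measurable]
  have \<eta> [measurable]: "\<eta> j \<in> borel_measurable M" if "j \<le> n" for j
    using assms(6)[OF that] by (simp add: std_complex_normal_def distributed_def)
  have distr_\<eta>: "distr M borel (\<eta> j) = ?N" if "j \<le> n" for j
  proof -
    have "distr M borel (\<eta> j) = distr M lborel (\<eta> j)" by (rule distr_cong) simp_all
    also have "\<dots> = ?N"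
      unfolding std_complex_normal_measure_def
      using assms(6)[OF that] by (intro distributed_distr_eq_density) (simp add: std_complex_normal_def)
    finally show ?thesis .
  qed
  have "distr M (PiM {..n} (\<lambda>_. borel)) (\<lambda>\<omega>. \<lambda>j\<in>{..n}. \<eta> j \<omega>) = PiM {..n} (\<lambda>j. distr M borel (\<eta> j))"
    using assms(5) \<eta> by (subst (asm) indep_vars_iff_distr_eq_PiM') auto
  also have "\<dots> = PiM {..n} (\<lambda>_. ?N)"
    using distr_\<eta> by (intro PiM_cong) auto
  finally have joint: "distr M (PiM {..n} (\<lambda>_. borel)) (\<lambda>\<omega>. \<lambda>j\<in>{..n}. \<eta> j \<omega>) = PiM {..n} (\<lambda>_. ?N)" .
  have deg: "degree (\<Sum>j\<le>n. smult (x j) (\<phi> j)) \<le> n" for x :: "nat \<Rightarrow> complex"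
    using assms(3) by (intro degree_sum_le) (auto intro: order.trans[OF degree_smult_le])
  define R where "R = (\<lambda>\<omega>. root_count \<Theta> (random_poly n \<phi> \<eta> \<omega>) v)"
  have R_le: "R \<omega> \<le> n" for \<omega>
    unfolding R_def random_poly_def by (intro root_count_le_degree \<open>open \<Theta>\<close> deg)
  have [measurable]: "R \<in> measurable M (count_space UNIV)"
    unfolding R_def random_poly_def
    by (rule measurable_root_count[OF \<open>open \<Theta>\<close> deg]) (simp add: coeff_sum)
  have [measurable]: "(\<lambda>x. root_count \<Theta> (\<Sum>j\<le>n. smult (x j) (\<phi> j)) v)
       \<in> measurable (PiM {..n} (\<lambda>_. borel)) (count_space UNIV)"
    by (rule measurable_root_count[OF \<open>open \<Theta>\<close> deg]) (simp add: coeff_sum)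
  have "(\<integral>\<^sup>+\<omega>. of_nat (R \<omega>) \<partial>M) =
      (\<integral>\<^sup>+\<omega>. of_nat (root_count \<Theta> (\<Sum>j\<le>n. smult ((\<lambda>j\<in>{..n}. \<eta> j \<omega>) j) (\<phi> j)) v) \<partial>M)"
    unfolding R_def random_poly_def by simp
  also have "\<dots> = (\<integral>\<^sup>+x. of_nat (root_count \<Theta> (\<Sum>j\<le>n. smult (x j) (\<phi> j)) v)
      \<partial>distr M (PiM {..n} (\<lambda>_. borel)) (\<lambda>\<omega>. \<lambda>j\<in>{..n}. \<eta> j \<omega>))"
    by (subst nn_integral_distr) (auto intro!: measurable_restrict)
  also have "\<dots> = (\<integral>\<^sup>+z. ennreal (root_density n \<phi> v z) * indicator \<Theta> z \<partial>lborel)"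
    unfolding joint using assms(3,4) \<open>open \<Theta>\<close> by (intro nn_integral_root_count_PiM) auto
  finally have nn: "(\<integral>\<^sup>+\<omega>. ennreal (real (R \<omega>)) \<partial>M) =
      (\<integral>\<^sup>+z. ennreal (indicator \<Theta> z *\<^sub>R root_density n \<phi> v z) \<partial>lborel)"
    by (simp add: ennreal_of_nat_eq_real_of_nat)
       (auto intro!: nn_integral_cong split: split_indicator)
  have intR: "integrable M (\<lambda>\<omega>. real (R \<omega>))"
    using R_le by (intro integrable_const_bound[where B = "real n"]) auto
  have nonneg: "0 \<le> indicator \<Theta> z *\<^sub>R root_density n \<phi> v z" for z
    using root_density_nonneg[of \<phi>, OF assms(4)] by (auto split: split_indicator)
  have "(\<integral>\<^sup>+\<omega>. ennreal (real (R \<omega>)) \<partial>M) < \<infinity>"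
    using intR by (subst nn_integral_eq_integral) auto
  then have "integrable lborel (\<lambda>z. indicator \<Theta> z *\<^sub>R root_density n \<phi> v z)"
    unfolding nn using nonneg by (intro integrableI_nonneg) auto
  moreover have "(\<integral>\<omega>. real (R \<omega>) \<partial>M) = (\<integral>z. indicator \<Theta> z *\<^sub>R root_density n \<phi> v z \<partial>lborel)"
    using nn nonneg by (subst (1 2) integral_eq_nn_integral) auto
  ultimately show ?thesis
    using intR by (simp add: R_def set_integrable_def set_lebesgue_integral_def)
qed

end
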